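(* Let $\alpha\in(0,1]$ be rational and let $M^{*}=M^{*}_{\alpha}$ be the $(\mathcal{C}^{>0}_{\alpha},\leq^{*}_{\alpha})$-generic structure. Then the structure $\langle\mathbb{Q},<\rangle$ is (first-order) interpretable in $M^{*}$.
   Context: $\mathcal{L}=\{R\}$ with $R$ a ternary relation symbol; in all structures $R$ is symmetric and holds only of triples of distinct elements. $\mathcal{C}$ is the class of all finite such structures (including $\emptyset$). For $\alpha\in(0,1]$ and $A\in\mathcal{C}$, $\delta_{\alpha}(A)=|A|-\alpha|R^{A}|$, where $|R^{A}|$ is the number of relations in $A$ (counted as unordered triples). For finite $A\subseteq B$: $A\leq^{*}_{\alpha}B$ means $\delta_{\alpha}(A)<\delta_{\alpha}(C)$ for every $C$ with $A\subsetneq C\subseteq B$. $\mathcal{C}^{>0}_{\alpha}=\{A\in\mathcal{C}:\emptyset\leq^{*}_{\alpha}A\}$, and $\bar{\mathcal{C}}^{>0}_{\alpha}$ is the class of all $\mathcal{L}$-structures all of whose finite substructures lie in $\mathcal{C}^{>0}_{\alpha}$. For $M\in\bar{\mathcal{C}}^{>0}_{\alpha}$ and finite $A\subseteq M$, $A\leq^{*}_{\alpha}M$ means $A\leq^{*}_{\alpha}B$ for all finite $B$ with $A\subseteq B\subseteq M$. $M^{*}_{\alpha}$ is the (unique up to isomorphism) countable $\mathcal{L}$-structure $M$ with: (1) $M\in\bar{\mathcal{C}}^{>0}_{\alpha}$; (2) whenever $A\leq^{*}_{\alpha}M$ is finite and $A\leq^{*}_{\alpha}B\in\mathcal{C}^{>0}_{\alpha}$,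 there is $B'\subseteq M$ with $B'\cong_{A}B$ and $B'\leq^{*}_{\alpha}M$; (3) $M$ is the union of a chain $\{A_{i}:i\in\omega\}$ with $A_{i}\in\mathcal{C}^{>0}_{\alpha}$ and $A_{i}\leq^{*}_{\alpha}A_{i+1}$. *)

theory Defs
  imports Complex_Main "HOL-Library.Countable_Set" "HOL-Library.Infinite_Typeclass"
begin

section \<open>Relational structures and first-order formulas\<close>

record ('r, 'a) struct =
  univ :: "'a set"
  rel :: "'r \<Rightarrow> 'a list set"

definition is_struct :: "('r \<Rightarrow> nat) \<Rightarrow> ('r, 'a) struct \<Rightarrow> bool" where
  "is_struct ar A \<longleftrightarrow> (\<forall>r. \<forall>xs \<in> rel A r. length xs = ar r \<and> set xs \<subseteq> univ A)"

definition substructure :: "('r, 'a) struct \<Rightarrow> ('r, 'a) struct \<Rightarrow> bool" where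
  "substructure A B \<longleftrightarrow> univ A \<subseteq> univ B \<and> (\<forall>r. rel A r = rel B r \<inter> lists (univ A))"

definition struct_iso :: "('a \<Rightarrow> 'b) \<Rightarrow> ('r, 'a) struct \<Rightarrow> ('r, 'b) struct \<Rightarrow> bool" where
  "struct_iso g A B \<longleftrightarrow> bij_betw g (univ A) (univ B) \<and>
     (\<forall>r. \<forall>xs \<in> lists (univ A). xs \<in> rel A r \<longleftrightarrow> map g xs \<in> rel B r)"

text \<open>Variables are named by natural numbers.\<close>

datatype 'r fm =
    Equal nat nat
  | Atom 'r "nat list"
  | Neg "'r fm"
  | Conj "'r fm" "'r fm"
  | Ex nat "'r fm"

primrec fm_over :: "('r \<Rightarrow> nat) \<Rightarrow> 'r fm \<Rightarrow> bool" where
  "fm_over ar (Equal i j) \<longleftrightarrow> True"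
| "fm_over ar (Atom r is) \<longleftrightarrow> length is = ar r"
| "fm_over ar (Neg p) \<longleftrightarrow> fm_over ar p"
| "fm_over ar (Conj p q) \<longleftrightarrow> fm_over ar p \<and> fm_over ar q"
| "fm_over ar (Ex i p) \<longleftrightarrow> fm_over ar p"

primrec free_vars :: "'r fm \<Rightarrow> nat set" where
  "free_vars (Equal i j) = {i, j}"
| "free_vars (Atom r is) = set is"
| "free_vars (Neg p) = free_vars p"
| "free_vars (Conj p q) = free_vars p \<union> free_vars q"
| "free_vars (Ex i p) = free_vars p - {i}"

primrec sat :: "('r, 'a) struct \<Rightarrow> (nat \<Rightarrow> 'a) \<Rightarrow> 'r fm \<Rightarrow> bool" where
  "sat A e (Equal i j) \<longleftrightarrow> e i = e j"
| "sat A e (Atom r is) \<longleftrightarrow> map e is \<in> rel A r"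
| "sat A e (Neg p) \<longleftrightarrow> \<not> sat A e p"
| "sat A e (Conj p q) \<longleftrightarrow> sat A e p \<and> sat A e q"
| "sat A e (Ex i p) \<longleftrightarrow> (\<exists>a \<in> univ A. sat A (e(i := a)) p)"

text \<open>A formula in the free variables \<open>0, \<dots>, n - 1\<close>, and the set of \<open>n\<close>-tuples it defines.\<close>

definition fm_in :: "('r \<Rightarrow> nat) \<Rightarrow> nat \<Rightarrow> 'r fm \<Rightarrow> bool" where
  "fm_in ar n p \<longleftrightarrow> fm_over ar p \<and> free_vars p \<subseteq> {..<n}"

definition defined_set :: "('r, 'a) struct \<Rightarrow> nat \<Rightarrow> 'r fm \<Rightarrow> 'a list set" where
  "defined_set A n p = {xs. length xs = n \<and> set xs \<subseteq> univ A \<and> sat A (\<lambda>i. xs ! i) p}"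

text \<open>
  First-order interpretation without parameters, as in Hodges: elements of \<open>B\<close> are represented
  by \<open>n\<close>-tuples of \<open>A\<close> satisfying \<open>dom\<close>, through a surjective coordinate map \<open>f\<close>, such that
  equality and every basic relation of \<open>B\<close> pull back to relations definable in \<open>A\<close>.
  A tuple of representatives is passed to a formula as the concatenation of its entries.
\<close>

definition interpretable_in ::
  "('s \<Rightarrow> nat) \<Rightarrow> ('s, 'b) struct \<Rightarrow> ('r \<Rightarrow> nat) \<Rightarrow> ('r, 'a) struct \<Rightarrow> bool" where
  "interpretable_in arB B arA A \<longleftrightarrow>
    (\<exists>(n::nat) dom eq rl (f :: 'a list \<Rightarrow> 'b).
       n > 0 \<and>
       fm_in arA n dom \<and>
       fm_in arA (2 * n) eq \<and>
       (\<forall>s. fm_in arA (arB s * n) (rl s)) \<and>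
       f ` defined_set A n dom = univ B \<and>
       (\<forall>xs \<in> defined_set A n dom. \<forall>ys \<in> defined_set A n dom.
          f xs = f ys \<longleftrightarrow> xs @ ys \<in> defined_set A (2 * n) eq) \<and>
       (\<forall>s. \<forall>xss \<in> lists (defined_set A n dom). length xss = arB s \<longrightarrow>
          (map f xss \<in> rel B s \<longleftrightarrow> concat xss \<in> defined_set A (arB s * n) (rl s))))"

datatype ord_sym = Less

primrec ord_arity :: "ord_sym \<Rightarrow> nat" where
  "ord_arity Less = 2"

definition rat_order :: "(ord_sym, rat) struct" where
  "rat_order = \<lparr>univ = UNIV, rel = (\<lambda>_. {[x, y] | x y. x < y})\<rparr>"


section \<open>Symmetric irreflexive ternary structures and the generic structure\<close>

datatype hyp_sym = R

primrec hyp_arity :: "hyp_sym \<Rightarrow> nat" where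
  "hyp_arity R = 3"

definition hyp_struct :: "(hyp_sym, 'a) struct \<Rightarrow> bool" where
  "hyp_struct A \<longleftrightarrow> is_struct hyp_arity A \<and> (\<forall>xs \<in> rel A R. distinct xs) \<and>
     (\<forall>x y z. [x, y, z] \<in> rel A R \<longrightarrow> [y, x, z] \<in> rel A R \<and> [x, z, y] \<in> rel A R)"

definition class_C :: "(hyp_sym, 'a) struct set" where
  "class_C = {A. hyp_struct A \<and> finite (univ A)}"

text \<open>The image under \<^const>\<open>set\<close> turns the ordered triples into unordered ones.\<close>

definition predim :: "real \<Rightarrow> (hyp_sym, 'a) struct \<Rightarrow> real" where
  "predim \<alpha> A = real (card (univ A)) - \<alpha> * real (card (set ` rel A R))"

definition strong_fin :: "real \<Rightarrow> (hyp_sym, 'a) struct \<Rightarrow> (hyp_sym, 'a) struct \<Rightarrow> bool" where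
  "strong_fin \<alpha> A B \<longleftrightarrow> finite (univ B) \<and> substructure A B \<and>
     (\<forall>C. substructure A C \<and> A \<noteq> C \<and> substructure C B \<longrightarrow> predim \<alpha> A < predim \<alpha> C)"

definition empty_struct :: "('r, 'a) struct" where
  "empty_struct = \<lparr>univ = {}, rel = (\<lambda>_. {})\<rparr>"

definition class_pos :: "real \<Rightarrow> (hyp_sym, 'a) struct set" where
  "class_pos \<alpha> = {A \<in> class_C. strong_fin \<alpha> empty_struct A}"

definition class_pos_bar :: "real \<Rightarrow> (hyp_sym, 'a) struct set" where
  "class_pos_bar \<alpha> = {M. hyp_struct M \<and>
     (\<forall>A. substructure A M \<and> finite (univ A) \<longrightarrow> A \<in> class_pos \<alpha>)}"

definition strong_in :: "real \<Rightarrow> (hyp_sym, 'a) struct \<Rightarrow> (hyp_sym, 'a) struct \<Rightarrow> bool" where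
  "strong_in \<alpha> A M \<longleftrightarrow> finite (univ A) \<and> substructure A M \<and>
     (\<forall>B. finite (univ B) \<and> substructure A B \<and> substructure B M \<longrightarrow> strong_fin \<alpha> A B)"

text \<open>
  The extensions \<open>B\<close> in the second clause range over structures on the same type as \<open>M\<close>.
  As this type is infinite, every finite extension of \<open>A\<close> occurs there up to isomorphism
  over \<open>A\<close>, so no extension is lost; over a finite type the clause would be too weak.
\<close>

definition generic :: "real \<Rightarrow> (hyp_sym, 'a::infinite) struct \<Rightarrow> bool" where
  "generic \<alpha> M \<longleftrightarrow>
     countable (univ M) \<and>
     M \<in> class_pos_bar \<alpha> \<and>
     (\<forall>A B. strong_in \<alpha> A M \<and> strong_fin \<alpha> A B \<and> B \<in> class_pos \<alpha> \<longrightarrow>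
        (\<exists>B' g. substructure B' M \<and> struct_iso g B B' \<and> (\<forall>a \<in> univ A. g a = a) \<and>
           strong_in \<alpha> B' M)) \<and>
     (\<exists>A :: nat \<Rightarrow> (hyp_sym, 'a) struct.
        (\<forall>i. A i \<in> class_pos \<alpha> \<and> strong_fin \<alpha> (A i) (A (Suc i))) \<and>
        univ M = (\<Union>i. univ (A i)) \<and> (\<forall>r. rel M r = (\<Union>i. rel (A i) r)))"

end

theory Submission
  imports Defs
begin

text \<open>
  Write \<open>\<alpha> = p / q\<close>. A gadget over base points \<open>w\<^sub>0, \<dots>, w\<^sub>q\<close> and an arbitrary tuple \<open>v\<close> consists of
  \<open>4p\<close> new points and \<open>4q\<close> relations through them (the factor 4 makes room for quadruples \<open>v\<close>),
  distributed in a balanced way: its relative predimension is zero, every part of it has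
  nonnegative relative predimension, and positive one once \<open>w\<^sub>0\<close> is missing. Hence a gadget over a
  strong set lies inside that set, whereas new base points together with any finite family of
  gadgets over a given strong set form a strong extension, which therefore occurs in the generic
  structure. The points that start a gadget over \<open>(w, v)\<close> thus form a uniformly definable family of
  finite sets realising all cardinalities, and the gadgets over new base points code every finite
  relation on a strong set. Rational numbers are represented as quotients of two such
  cardinalities; they are compared through coded injections between products of two sets.
\<close>

section \<open>Structures as 3-uniform hypergraphs\<close>

text \<open>The inequality in the definition of strong extensions is strict, so an extension of
  relative predimension exactly zero is never strong. This confines gadgets to strong sets and makes
  the definable sets finite; it is possible because a rational \<alpha> allows 4p points to be
  balanced against 4q relations. Relations are unordered, so a relation does not tell which
  coordinate of \<open>v\<close> it carries. Hence the new points form a chain that starts at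
  \<open>w\<^sub>0\<close>, with one link per point, and the coordinate is read off from the
  position in the chain. The other 4q - 4p relations are spokes through \<open>w\<^sub>0\<close>.
  Once \<open>w\<^sub>0\<close> is missing, only pieces of the chain remain, which have fewer links
  than points, and \<alpha> \<le> 1 makes their predimension positive. The interpretation has no
  parameters, so the base points belong to the tuple that represents a rational, and two such tuples
  may have different base points. The inequality between m / n and m' / n' is cross-multiplied, so
  that it compares the sizes of two products of sets. A third base tuple, bound by an existential
  quantifier, codes the injection; its graph is a quaternary relation, which is why quadruples
  occur.\<close>

definition edges :: "(hyp_sym, 'a) struct \<Rightarrow> 'a set set" where
  "edges A = set ` rel A R"

text \<open>\<open>H\<close> may contain sets that are not subsets of \<open>X\<close>. One ambient
  \<open>H\<close> thus describes all induced substructures, and inclusions of structures become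
  inclusions of vertex sets.\<close>

definition hyp_of :: "'a set \<Rightarrow> 'a set set \<Rightarrow> (hyp_sym, 'a) struct" where
  "hyp_of X H = \<lparr>univ = X, rel = (\<lambda>_. {xs. length xs = 3 \<and> set xs \<in> H \<and> set xs \<subseteq> X})\<rparr>"

definition uniform3 :: "'a set set \<Rightarrow> bool" where
  "uniform3 H \<longleftrightarrow> (\<forall>t \<in> H. card t = 3)"

definition hdim :: "real \<Rightarrow> 'a set set \<Rightarrow> 'a set \<Rightarrow> real" where
  "hdim \<alpha> H X = real (card X) - \<alpha> * real (card (H \<inter> Pow X))"

definition hstrong :: "real \<Rightarrow> 'a set set \<Rightarrow> 'a set \<Rightarrow> 'a set \<Rightarrow> bool" where
  "hstrong \<alpha> H X Y \<longleftrightarrow> finite Y \<and> X \<subseteq> Y \<and>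
     (\<forall>Z. X \<subset> Z \<longrightarrow> Z \<subseteq> Y \<longrightarrow> hdim \<alpha> H X < hdim \<alpha> H Z)"

definition hclosed :: "real \<Rightarrow> 'a set set \<Rightarrow> 'a set \<Rightarrow> 'a set \<Rightarrow> bool" where
  "hclosed \<alpha> H U X \<longleftrightarrow> finite X \<and> X \<subseteq> U \<and>
     (\<forall>Y. finite Y \<longrightarrow> X \<subseteq> Y \<longrightarrow> Y \<subseteq> U \<longrightarrow> hstrong \<alpha> H X Y)"

lemma univ_hyp_of [simp]: "univ (hyp_of X H) = X"
  by (simp add: hyp_of_def)

lemma mem_rel_hyp_of: "xs \<in> rel (hyp_of X H) r \<longleftrightarrow> length xs = 3 \<and> set xs \<in> H \<and> set xs \<subseteq> X"
  by (simp add: hyp_of_def)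

lemma uniform3_distinct:
  assumes "uniform3 H" "set xs \<in> H" "length xs = 3"
  shows "distinct xs"
  using assms by (metis card_distinct uniform3_def)

lemma edges_hyp_of:
  assumes "uniform3 H"
  shows "edges (hyp_of X H) = H \<inter> Pow X"
proof (intro set_eqI iffI)
  fix t assume "t \<in> H \<inter> Pow X"
  then have t: "card t = 3" "t \<in> H" "t \<subseteq> X"
    using assms by (auto simp: uniform3_def)
  then obtain x y z where "t = {x, y, z}" by (auto simp: card_3_iff)
  then have "[x, y, z] \<in> rel (hyp_of X H) R" "set [x, y, z] = t"
    using t by (auto simp: mem_rel_hyp_of)
  then show "t \<in> edges (hyp_of X H)" unfolding edges_def by (metis imageI)
qed (auto simp: edges_def mem_rel_hyp_of)

lemma hyp_struct_hyp_of:
  assumes "uniform3 H"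
  shows "hyp_struct (hyp_of X H)"
  unfolding hyp_struct_def is_struct_def
proof (intro conjI allI ballI impI)
  fix r :: hyp_sym and xs assume "xs \<in> rel (hyp_of X H) r"
  then show "length xs = hyp_arity r" by (cases r) (simp add: mem_rel_hyp_of)
  show "set xs \<subseteq> univ (hyp_of X H)"
    using \<open>xs \<in> rel (hyp_of X H) r\<close> by (simp add: mem_rel_hyp_of)
next
  fix xs assume "xs \<in> rel (hyp_of X H) R"
  then show "distinct xs" using assms by (auto simp: mem_rel_hyp_of intro: uniform3_distinct)
qed (auto simp: mem_rel_hyp_of insert_commute)

lemma uniform3_edges: "hyp_struct A \<Longrightarrow> uniform3 (edges A)"
  by (auto simp: hyp_struct_def is_struct_def uniform3_def edges_def distinct_card)

text \<open>The two transpositions in \<open>hyp_struct\<close> generate all permutations of three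
  positions, so only the set of entries of a triple matters.\<close>

lemma hyp_struct_mem_rel:
  assumes A: "hyp_struct A"
  shows "xs \<in> rel A R \<longleftrightarrow> length xs = 3 \<and> set xs \<in> edges A"
proof
  assume "xs \<in> rel A R"
  then show "length xs = 3 \<and> set xs \<in> edges A"
    using A by (auto simp: hyp_struct_def is_struct_def edges_def)
next
  have len: "ys \<in> rel A R \<Longrightarrow> length ys = 3 \<and> distinct ys" for ys
    using A by (auto simp: hyp_struct_def is_struct_def)
  have sym: "[x, y, z] \<in> rel A R \<Longrightarrow> [y, x, z] \<in> rel A R \<and> [x, z, y] \<in> rel A R" for x y z
    using A unfolding hyp_struct_def by blast
  assume xs: "length xs = 3 \<and> set xs \<in> edges A"
  then obtain ys where ys: "ys \<in> rel A R" "set xs = set ys" by (auto simp: edges_def)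
  obtain a b c where abc: "xs = [a, b, c]"
    using xs by (auto simp: length_Suc_conv numeral_3_eq_3)
  obtain x y z where xyz: "ys = [x, y, z]"
    using len[OF ys(1)] by (auto simp: length_Suc_conv numeral_3_eq_3)
  have d: "distinct [x, y, z]" using len[OF ys(1)] xyz by simp
  have "distinct xs"
    using ys(2) len[OF ys(1)] xs by (metis card_distinct distinct_card)
  then have "distinct [a, b, c]" "{a, b, c} \<subseteq> {x, y, z}" using ys(2) abc xyz by auto
  then have "[a, b, c] \<in> {[x, y, z], [y, x, z], [x, z, y], [z, x, y], [y, z, x], [z, y, x]}"
    by simp (elim conjE disjE; simp)
  moreover have "{[x, y, z], [y, x, z], [x, z, y], [z, x, y], [y, z, x], [z, y, x]} \<subseteq> rel A R"
    using ys(1) sym unfolding xyz by blast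
  ultimately show "xs \<in> rel A R" unfolding abc by blast
qed

lemma struct_eqI:
  fixes A B :: "(hyp_sym, 'a) struct"
  assumes "univ A = univ B" "rel A R = rel B R"
  shows "A = B"
proof -
  have "rel A = rel B" using assms(2) by (metis ext hyp_sym.exhaust)
  then show ?thesis using assms(1) by (cases A; cases B) simp
qed

lemma substructure_hyp_struct_iff:
  assumes A: "hyp_struct A"
  shows "substructure C A \<longleftrightarrow> univ C \<subseteq> univ A \<and> C = hyp_of (univ C) (edges A)"
proof
  assume C: "substructure C A"
  then have "rel C R = rel (hyp_of (univ C) (edges A)) R"
    using hyp_struct_mem_rel[OF A] by (auto simp: substructure_def mem_rel_hyp_of)
  then show "univ C \<subseteq> univ A \<and> C = hyp_of (univ C) (edges A)"
    using C by (auto simp: substructure_def intro: struct_eqI)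
next
  assume *: "univ C \<subseteq> univ A \<and> C = hyp_of (univ C) (edges A)"
  have "rel C r = rel A r \<inter> lists (univ C)" for r
  proof (cases r)
    case R
    have "rel C R = rel (hyp_of (univ C) (edges A)) R" using * by simp
    then show ?thesis using hyp_struct_mem_rel[OF A] R by (auto simp: mem_rel_hyp_of)
  qed
  then show "substructure C A" using * by (simp add: substructure_def)
qed

lemma hyp_of_cong: "H \<inter> Pow X = H' \<inter> Pow X \<Longrightarrow> hyp_of X H = hyp_of X H'"
  unfolding hyp_of_def by auto

lemma hdim_cong: "H \<inter> Pow X = H' \<inter> Pow X \<Longrightarrow> hdim \<alpha> H X = hdim \<alpha> H' X"
  unfolding hdim_def by simp

lemma substructure_hyp_of_iff:
  assumes "uniform3 H"
  shows "substructure C (hyp_of X H) \<longleftrightarrow> univ C \<subseteq> X \<and> C = hyp_of (univ C) H"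
proof -
  have "hyp_of (univ C) (H \<inter> Pow X) = hyp_of (univ C) H" if "univ C \<subseteq> X"
    using that by (intro hyp_of_cong) auto
  then show ?thesis
    using substructure_hyp_struct_iff[OF hyp_struct_hyp_of[OF assms]]
    by (simp add: edges_hyp_of[OF assms]) metis
qed

lemma predim_hyp_of: "uniform3 H \<Longrightarrow> predim \<alpha> (hyp_of X H) = hdim \<alpha> H X"
  using edges_hyp_of[of H X] by (simp add: predim_def hdim_def edges_def)

lemma strong_fin_hyp_of_iff:
  assumes H: "uniform3 H"
  shows "strong_fin \<alpha> (hyp_of X H) (hyp_of Y H) \<longleftrightarrow> hstrong \<alpha> H X Y"
proof
  assume *: "strong_fin \<alpha> (hyp_of X H) (hyp_of Y H)"
  then have XY: "finite Y" "X \<subseteq> Y"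
    using substructure_hyp_of_iff[OF H] by (auto simp: strong_fin_def)
  have "hdim \<alpha> H X < hdim \<alpha> H Z" if Z: "X \<subset> Z" "Z \<subseteq> Y" for Z
  proof -
    have "substructure (hyp_of X H) (hyp_of Z H)" "substructure (hyp_of Z H) (hyp_of Y H)"
      using Z by (auto simp: substructure_hyp_of_iff[OF H])
    moreover have "hyp_of X H \<noteq> hyp_of Z H" using Z by (metis psubset_eq univ_hyp_of)
    ultimately show ?thesis
      using * predim_hyp_of[OF H] unfolding strong_fin_def by metis
  qed
  then show "hstrong \<alpha> H X Y" using XY by (auto simp: hstrong_def)
next
  assume *: "hstrong \<alpha> H X Y"
  have "predim \<alpha> (hyp_of X H) < predim \<alpha> C"
    if C: "substructure (hyp_of X H) C" "hyp_of X H \<noteq> C" "substructure C (hyp_of Y H)" for C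
  proof -
    have C': "univ C \<subseteq> Y" "C = hyp_of (univ C) H"
      using C(3) substructure_hyp_of_iff[OF H] by auto
    have "X \<subseteq> univ C" using C(1) by (auto simp: substructure_def)
    moreover have "X \<noteq> univ C" using C(2) C' by metis
    ultimately have "hdim \<alpha> H X < hdim \<alpha> H (univ C)"
      using * C' by (auto simp: hstrong_def)
    then show ?thesis using predim_hyp_of[OF H] C'(2) by metis
  qed
  then show "strong_fin \<alpha> (hyp_of X H) (hyp_of Y H)"
    using * substructure_hyp_of_iff[OF H] by (auto simp: strong_fin_def hstrong_def)
qed

lemma class_pos_hyp_of_iff:
  fixes X :: "'a set"
  assumes H: "uniform3 H"
  shows "hyp_of X H \<in> class_pos \<alpha> \<longleftrightarrow> hstrong \<alpha> H {} X"
proof -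
  have emp: "(empty_struct :: (hyp_sym, 'a) struct) = hyp_of {} H"
    using H by (auto simp: empty_struct_def hyp_of_def uniform3_def intro!: ext)
  show ?thesis
    using strong_fin_hyp_of_iff[OF H, of \<alpha> "{}" X] hyp_struct_hyp_of[OF H, of X]
    unfolding class_pos_def class_C_def emp by (auto simp: hstrong_def)
qed

lemma strong_in_hyp_of_iff:
  assumes M: "hyp_struct M"
  shows "strong_in \<alpha> (hyp_of X (edges M)) M \<longleftrightarrow> hclosed \<alpha> (edges M) (univ M) X"
proof -
  let ?H = "edges M"
  have H: "uniform3 ?H" using M by (rule uniform3_edges)
  have sub: "substructure C M \<longleftrightarrow> univ C \<subseteq> univ M \<and> C = hyp_of (univ C) ?H" for C
    using substructure_hyp_struct_iff[OF M] .
  show ?thesis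
  proof
    assume *: "strong_in \<alpha> (hyp_of X ?H) M"
    have "hstrong \<alpha> ?H X Y" if "finite Y" "X \<subseteq> Y" "Y \<subseteq> univ M" for Y
    proof -
      have "substructure (hyp_of X ?H) (hyp_of Y ?H)" "substructure (hyp_of Y ?H) M"
        using that by (auto simp: substructure_hyp_of_iff[OF H] sub)
      then show ?thesis
        using * that(1) strong_fin_hyp_of_iff[OF H] unfolding strong_in_def
        by (metis univ_hyp_of)
    qed
    then show "hclosed \<alpha> ?H (univ M) X"
      using * sub by (auto simp: strong_in_def hclosed_def)
  next
    assume *: "hclosed \<alpha> ?H (univ M) X"
    have "strong_fin \<alpha> (hyp_of X ?H) B"
      if B: "finite (univ B)" "substructure (hyp_of X ?H) B" "substructure B M" for B
    proof -
      have "hstrong \<alpha> ?H X (univ B)"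
        using * B sub by (auto simp: hclosed_def substructure_def)
      then show ?thesis using strong_fin_hyp_of_iff[OF H] B(3) sub by metis
    qed
    then show "strong_in \<alpha> (hyp_of X ?H) M"
      using * sub by (auto simp: strong_in_def hclosed_def)
  qed
qed

section \<open>Submodularity of the predimension and transitivity of strong extensions\<close>

lemma hdim_submodular:
  assumes "finite X" "finite Y" "0 \<le> \<alpha>"
  shows "hdim \<alpha> H (X \<union> Y) + hdim \<alpha> H (X \<inter> Y) \<le> hdim \<alpha> H X + hdim \<alpha> H Y"
proof -
  have fin: "finite (H \<inter> Pow Z)" if "finite Z" for Z using that by simp
  have "card (H \<inter> Pow X) + card (H \<inter> Pow Y)
      = card (H \<inter> Pow X \<union> H \<inter> Pow Y) + card (H \<inter> Pow X \<inter> (H \<inter> Pow Y))"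
    using fin assms by (intro card_Un_Int) auto
  \<comment> \<open>A relation inside \<open>X\<close> or \<open>Y\<close> lies inside the union,
    and one inside both lies inside the intersection; relations that meet both differences only add
    to the right-hand side.\<close>
  also have "\<dots> \<le> card (H \<inter> Pow (X \<union> Y)) + card (H \<inter> Pow (X \<inter> Y))"
    using fin assms by (intro add_mono card_mono) auto
  finally have "\<alpha> * (real (card (H \<inter> Pow X)) + real (card (H \<inter> Pow Y)))
      \<le> \<alpha> * (real (card (H \<inter> Pow (X \<union> Y))) + real (card (H \<inter> Pow (X \<inter> Y))))"
    using assms(3) by (intro mult_left_mono) (simp_all flip: of_nat_add)
  moreover have "real (card X) + real (card Y) = real (card (X \<union> Y)) + real (card (X \<inter> Y))"
    using card_Un_Int[OF assms(1,2)] by simp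
  ultimately show ?thesis by (simp add: hdim_def algebra_simps)
qed

text \<open>For \<open>D\<close> between \<open>X\<close> and \<open>Z\<close>, submodularity splits
  the step from \<open>X\<close> to \<open>D\<close> into the step from \<open>X\<close> to
  \<open>D \<inter> Y\<close> and the step from \<open>Y\<close> to \<open>D \<union> Y\<close>. If
  both were trivial, \<open>D\<close> would be \<open>X\<close>; so one of them is proper and makes
  the inequality strict.\<close>

lemma hstrong_trans:
  assumes XY: "hstrong \<alpha> H X Y" and YZ: "hstrong \<alpha> H Y Z" and "0 \<le> \<alpha>"
  shows "hstrong \<alpha> H X Z"
  unfolding hstrong_def
proof (intro conjI allI impI)
  show "finite Z" "X \<subseteq> Z" using XY YZ by (auto simp: hstrong_def)
  fix D assume D: "X \<subset> D" "D \<subseteq> Z"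
  have fin: "finite D" "finite Y" using D XY YZ by (auto simp: hstrong_def intro: finite_subset)
  have sm: "hdim \<alpha> H (D \<union> Y) + hdim \<alpha> H (D \<inter> Y) \<le> hdim \<alpha> H D + hdim \<alpha> H Y"
    using fin assms(3) by (rule hdim_submodular)
  have low: "D \<inter> Y = X \<or> hdim \<alpha> H X < hdim \<alpha> H (D \<inter> Y)"
  proof (cases "D \<inter> Y = X")
    case False
    then have "X \<subset> D \<inter> Y" using XY D unfolding hstrong_def by blast
    then show ?thesis using XY unfolding hstrong_def by blast
  qed simp
  have up: "D \<union> Y = Y \<or> hdim \<alpha> H Y < hdim \<alpha> H (D \<union> Y)"
  proof (cases "D \<union> Y = Y")
    case False
    then have "Y \<subset> D \<union> Y" "D \<union> Y \<subseteq> Z" using YZ D unfolding hstrong_def by blast+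
    then show ?thesis using YZ unfolding hstrong_def by blast
  qed simp
  show "hdim \<alpha> H X < hdim \<alpha> H D"
  proof (cases "D \<inter> Y = X")
    case True
    then have "D \<union> Y \<noteq> Y" using D by blast
    then show ?thesis using sm up unfolding True by linarith
  next
    case False
    then have "hdim \<alpha> H X < hdim \<alpha> H (D \<inter> Y)" using low by blast
    moreover have "hdim \<alpha> H Y \<le> hdim \<alpha> H (D \<union> Y)" using up by (metis less_imp_le order_refl)
    ultimately show ?thesis using sm by linarith
  qed
qed

lemma hstrong_mono: "hstrong \<alpha> H X Y \<Longrightarrow> X \<subseteq> Y' \<Longrightarrow> Y' \<subseteq> Y \<Longrightarrow> hstrong \<alpha> H X Y'"
  by (auto simp: hstrong_def intro: finite_subset)

lemma hstrong_cong:
  "H \<inter> Pow Y = H' \<inter> Pow Y \<Longrightarrow> hstrong \<alpha> H X Y \<longleftrightarrow> hstrong \<alpha> H' X Y"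
proof -
  assume *: "H \<inter> Pow Y = H' \<inter> Pow Y"
  have "hdim \<alpha> H Z = hdim \<alpha> H' Z" if "Z \<subseteq> Y" for Z
    using * that by (intro hdim_cong) blast
  then show ?thesis unfolding hstrong_def by (metis psubset_imp_subset subset_trans)
qed

section \<open>The generic structure\<close>

text \<open>The members of the exhausting chain are themselves closed: every finite subset of
  \<open>M\<close> lies in a later member, and strongness passes along the chain by
  transitivity.\<close>

lemma generic_exists_closed:
  assumes gen: "generic \<alpha> M" and "0 \<le> \<alpha>" and F: "finite F" "F \<subseteq> univ M"
  obtains B where "F \<subseteq> B" "hclosed \<alpha> (edges M) (univ M) B"
proof -
  let ?H = "edges M"
  have M: "hyp_struct M" using gen by (simp add: generic_def class_pos_bar_def)
  have "\<exists>A :: nat \<Rightarrow> (hyp_sym, 'a) struct.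
        (\<forall>i. A i \<in> class_pos \<alpha> \<and> strong_fin \<alpha> (A i) (A (Suc i))) \<and>
        univ M = (\<Union>i. univ (A i)) \<and> (\<forall>r. rel M r = (\<Union>i. rel (A i) r))"
    using gen unfolding generic_def by (elim conjE)
  then obtain A :: "nat \<Rightarrow> (hyp_sym, 'a) struct" where
    A0: "\<forall>i. A i \<in> class_pos \<alpha> \<and> strong_fin \<alpha> (A i) (A (Suc i))"
    and un: "univ M = (\<Union>i. univ (A i))" "\<forall>r. rel M r = (\<Union>i. rel (A i) r)"
    by (elim exE conjE) (rule that)
  have A: "strong_fin \<alpha> (A i) (A (Suc i))" "A i \<in> class_pos \<alpha>" for i using A0 by blast+
  have H: "uniform3 ?H" using M by (rule uniform3_edges)
  have step: "substructure (A i) (A (Suc i))" for i using A(1) by (simp add: strong_fin_def)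
  have sub: "substructure (A i) (A j)" if "i \<le> j" for i j
    using that
  proof (induction rule: dec_induct)
    case base
    have "hyp_struct (A i)" using A(2) by (simp add: class_pos_def class_C_def)
    then show ?case by (auto simp: substructure_def hyp_struct_def is_struct_def)
  next
    case (step k)
    show ?case
      using step(3) \<open>\<And>i. substructure (A i) (A (Suc i))\<close>[of k]
      by (fastforce simp: substructure_def)
  qed
  have subM: "substructure (A i) M" for i
    unfolding substructure_def
  proof (intro conjI allI)
    show "univ (A i) \<subseteq> univ M" using un by auto
    fix r show "rel (A i) r = rel M r \<inter> lists (univ (A i))"
    proof (intro set_eqI iffI)
      fix xs assume "xs \<in> rel (A i) r"
      then show "xs \<in> rel M r \<inter> lists (univ (A i))"
        using sub[of i i] un by (auto simp: substructure_def)
    next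
      \<comment> \<open>The relation is known from some stage \<open>j\<close>. As
        \<open>A i\<close> is an induced substructure of stage \<open>max i j\<close>, it already
        holds in \<open>A i\<close>.\<close>
      fix xs assume xs: "xs \<in> rel M r \<inter> lists (univ (A i))"
      then obtain j where j: "xs \<in> rel (A j) r" using un by auto
      then have "xs \<in> rel (A (max i j)) r"
        using sub[of j "max i j"] by (auto simp: substructure_def)
      then show "xs \<in> rel (A i) r"
        using sub[of i "max i j"] xs by (auto simp: substructure_def)
    qed
  qed
  then have Aeq: "A i = hyp_of (univ (A i)) ?H" for i
    using substructure_hyp_struct_iff[OF M] by blast
  have st: "hstrong \<alpha> ?H (univ (A i)) (univ (A (Suc i)))" for i
    using A(1)[of i] Aeq strong_fin_hyp_of_iff[OF H] by metis
  have fin: "finite (univ (A i))" for i using A(2)[of i] by (simp add: class_pos_def class_C_def)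
  have st': "hstrong \<alpha> ?H (univ (A i)) (univ (A j))" if "i \<le> j" for i j
    using that
  proof (induction rule: dec_induct)
    case base then show ?case using fin by (auto simp: hstrong_def)
  next
    case (step k) then show ?case using st[of k] assms(2) hstrong_trans by blast
  qed
  have mono: "univ (A i) \<subseteq> univ (A j)" if "i \<le> j" for i j
    using st'[OF that] by (simp add: hstrong_def)
  have cover: "\<exists>i. G \<subseteq> univ (A i)" if "finite G" "G \<subseteq> univ M" for G
    using that
  proof (induction G rule: finite_induct)
    case (insert x G)
    then obtain i j where "G \<subseteq> univ (A i)" "x \<in> univ (A j)" using un by auto
    then have "insert x G \<subseteq> univ (A (max i j))"
      using mono[of i "max i j"] mono[of j "max i j"] by auto
    then show ?case by blast
  qed simp
  obtain i where i: "F \<subseteq> univ (A i)" using cover F by blast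
  have "hstrong \<alpha> ?H (univ (A i)) Y" if Y: "finite Y" "univ (A i) \<subseteq> Y" "Y \<subseteq> univ M" for Y
  proof -
    obtain j where j: "Y \<subseteq> univ (A j)" using cover Y by blast
    have "Y \<subseteq> univ (A (max i j))" using j mono[of j "max i j"] by auto
    then show ?thesis using st'[of i "max i j"] Y hstrong_mono by fastforce
  qed
  then have "hclosed \<alpha> ?H (univ M) (univ (A i))"
    using fin un by (auto simp: hclosed_def)
  then show ?thesis using i that by blast
qed

lemma generic_hstrong_empty:
  assumes "generic \<alpha> M" "finite X" "X \<subseteq> univ M"
  shows "hstrong \<alpha> (edges M) {} X"
proof -
  have M: "hyp_struct M" using assms by (simp add: generic_def class_pos_bar_def)
  have "substructure (hyp_of X (edges M)) M"
    using substructure_hyp_struct_iff[OF M] assms by simp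
  then have "hyp_of X (edges M) \<in> class_pos \<alpha>"
    using assms by (simp add: generic_def class_pos_bar_def)
  then show ?thesis using class_pos_hyp_of_iff[OF uniform3_edges[OF M]] by blast
qed

text \<open>The extension property in terms of sets. The elements of \<open>Y\<close> outside
  \<open>B\<close> are mere names and may even be elements of \<open>M\<close>; hence
  \<open>H'\<close> is compared with \<open>edges M\<close> on \<open>B\<close> alone.\<close>

lemma generic_extension:
  assumes gen: "generic \<alpha> M" and "0 \<le> \<alpha>"
    and B: "hclosed \<alpha> (edges M) (univ M) B"
    and H': "uniform3 H'" "H' \<inter> Pow B = edges M \<inter> Pow B"
    and BY: "hstrong \<alpha> H' B Y"
  obtains g where "inj_on g Y" "g ` Y \<subseteq> univ M" "\<And>a. a \<in> B \<Longrightarrow> g a = a"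
    "\<And>t. t \<subseteq> Y \<Longrightarrow> t \<in> H' \<longleftrightarrow> g ` t \<in> edges M" "hclosed \<alpha> (edges M) (univ M) (g ` Y)"
proof -
  let ?H = "edges M"
  have M: "hyp_struct M" using gen by (simp add: generic_def class_pos_bar_def)
  have H: "uniform3 ?H" using M by (rule uniform3_edges)
  have Beq: "hyp_of B ?H = hyp_of B H'" using H'(2) by (intro hyp_of_cong) simp
  \<comment> \<open>Transitivity from the empty set through \<open>B\<close> to \<open>Y\<close>
    puts the extension into the class.\<close>
  have "hstrong \<alpha> ?H {} B" using B gen by (simp add: hclosed_def generic_hstrong_empty)
  then have "hstrong \<alpha> H' {} B" using hstrong_cong[OF H'(2)] by simp
  then have "hstrong \<alpha> H' {} Y" using BY assms(2) hstrong_trans by blast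
  then have "hyp_of Y H' \<in> class_pos \<alpha>" using class_pos_hyp_of_iff[OF H'(1)] by simp
  moreover have "strong_fin \<alpha> (hyp_of B ?H) (hyp_of Y H')"
    using BY strong_fin_hyp_of_iff[OF H'(1)] by (simp add: Beq)
  moreover have "strong_in \<alpha> (hyp_of B ?H) M" using B strong_in_hyp_of_iff[OF M] by simp
  moreover have "\<forall>A B. strong_in \<alpha> A M \<and> strong_fin \<alpha> A B \<and> B \<in> class_pos \<alpha> \<longrightarrow>
        (\<exists>B' g. substructure B' M \<and> struct_iso g B B' \<and> (\<forall>a \<in> univ A. g a = a) \<and>
           strong_in \<alpha> B' M)"
    using gen unfolding generic_def by (elim conjE)
  ultimately have "\<exists>B' g. substructure B' M \<and> struct_iso g (hyp_of Y H') B' \<and>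
      (\<forall>a \<in> univ (hyp_of B ?H). g a = a) \<and> strong_in \<alpha> B' M"
    by metis
  then obtain B' g where B': "substructure B' M" "struct_iso g (hyp_of Y H') B'"
    "\<forall>a \<in> B. g a = a" "strong_in \<alpha> B' M"
    by auto
  have g: "bij_betw g Y (univ B')" using B'(2) by (simp add: struct_iso_def)
  then have inj: "inj_on g Y" and im: "g ` Y = univ B'" by (auto simp: bij_betw_def)
  have B'eq: "B' = hyp_of (g ` Y) ?H" and sub: "g ` Y \<subseteq> univ M"
    using B'(1) substructure_hyp_struct_iff[OF M] im by auto
  have "t \<in> H' \<longleftrightarrow> g ` t \<in> ?H" if t: "t \<subseteq> Y" for t
  proof -
    have c: "card (g ` t) = card t" using inj t by (meson card_image inj_on_subset)
    show ?thesis
    \<comment> \<open>The isomorphism speaks of triples; sets of any other size are relations on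
      neither side.\<close>
    proof (cases "card t = 3")
      case True
      then obtain x y z where xyz: "t = {x, y, z}" by (auto simp: card_3_iff)
      have "[x, y, z] \<in> rel (hyp_of Y H') R \<longleftrightarrow> map g [x, y, z] \<in> rel B' R"
        using B'(2) t unfolding struct_iso_def xyz by (metis (no_types, lifting) empty_set
          insert_subset list.simps(15) lists_eq_set mem_Collect_eq univ_hyp_of)
      then show ?thesis using t unfolding B'eq mem_rel_hyp_of xyz by (auto simp: image_subset_iff)
    next
      case False
      then show ?thesis using c H'(1) H by (auto simp: uniform3_def)
    qed
  qed
  moreover have "hclosed \<alpha> ?H (univ M) (g ` Y)"
    using B'(4) strong_in_hyp_of_iff[OF M] unfolding B'eq by simp
  ultimately show ?thesis using that inj sub B'(3) by blast
qed

section \<open>Gadgets of relative predimension zero\<close>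

locale slope =
  fixes p q :: nat
  assumes p_pos: "0 < p" and p_le_q: "p \<le> q"
begin

text \<open>Differences of the floors of q i / p: integers with mean q / p whose partial sums stay
  below the line of slope q / p as closely as integers can.\<close>

definition deg :: "nat \<Rightarrow> nat" where
  "deg i = q * Suc i div p - q * i div p"

text \<open>Consecutive links share a point of the chain from \<open>w 0\<close> through
  \<open>z 0\<close>, \<open>z 1\<close> and so on; the entry \<open>v i\<close> is attached to the
  link at position \<open>i\<close>.\<close>

definition link :: "(nat \<Rightarrow> 'a) \<Rightarrow> (nat \<Rightarrow> 'a) \<Rightarrow> (nat \<Rightarrow> 'a) \<Rightarrow> nat \<Rightarrow> 'a set" where
  "link w v z i = {z i, if i = 0 then w 0 else z (i - 1), v i}"

text \<open>Together with its link, \<open>z i\<close> has \<open>deg i\<close> relations in which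
  it is the latest chain point. All spokes pass through \<open>w 0\<close>, so a set without
  \<open>w 0\<close> contains none of them.\<close>

definition spokes :: "(nat \<Rightarrow> 'a) \<Rightarrow> (nat \<Rightarrow> 'a) \<Rightarrow> nat \<Rightarrow> 'a set set" where
  "spokes w z i = (\<lambda>l. {z i, w 0, w l}) ` {1..<deg i}"

definition gadget :: "(nat \<Rightarrow> 'a) \<Rightarrow> (nat \<Rightarrow> 'a) \<Rightarrow> (nat \<Rightarrow> 'a) \<Rightarrow> 'a set set" where
  "gadget w v z = (\<Union>i<4 * p. insert (link w v z i) (spokes w z i))"

text \<open>Entries of \<open>v\<close> may repeat, since constant tuples are coded as well. Base
  points, new points and entries are kept separate, so that relations have three elements and
  distinct ones do not coincide.\<close>

definition apart :: "(nat \<Rightarrow> 'a) \<Rightarrow> (nat \<Rightarrow> 'a) \<Rightarrow> (nat \<Rightarrow> 'a) \<Rightarrow> bool" where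
  "apart w v z \<longleftrightarrow>
     (\<forall>i \<in> {..q}. \<forall>j \<in> {..q}. i \<noteq> j \<longrightarrow> w i \<noteq> w j) \<and>
     (\<forall>i \<in> {..<4 * p}. \<forall>j \<in> {..<4 * p}. i \<noteq> j \<longrightarrow> z i \<noteq> z j) \<and>
     (\<forall>i \<in> {..<4 * p}. \<forall>j \<in> {..<4 * p}. z i \<noteq> v j) \<and>
     (\<forall>i \<in> {..<4 * p}. \<forall>j \<in> {..q}. z i \<noteq> w j \<and> v i \<noteq> w j)"

section \<open>The balanced degree sequence of slope q / p\<close>

lemma q_pos: "0 < q" using p_pos p_le_q by simp

lemma div_le_div_Suc: "q * i div p \<le> q * Suc i div p"
  by (rule div_le_mono) simp

lemma deg_pos: "0 < deg i"
proof -
  have "q * i div p + 1 = (q * i + p) div p" using p_pos by simp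
  also have "\<dots> \<le> q * Suc i div p" using p_le_q by (intro div_le_mono) simp
  finally show ?thesis by (simp add: deg_def)
qed

text \<open>Keeps the index \<open>l < deg i\<close> of a spoke within \<open>{..q}\<close>, the
  range of the base points.\<close>

lemma deg_le: "deg i \<le> Suc q"
proof -
  have "q * Suc i div p \<le> (q * i + q * p) div p" using p_pos by (intro div_le_mono) simp
  also have "\<dots> = q * i div p + q" using p_pos by simp
  finally show ?thesis by (simp add: deg_def)
qed

lemma sum_deg: "(\<Sum>i<t. deg i) = q * t div p"
  by (induction t) (use div_le_div_Suc in \<open>simp_all add: deg_def\<close>)

text \<open>Difference of two divisions with remainder; it passes the remainder of q i modulo p on
  from one index to the next.\<close>

lemma p_deg: "p * deg i + q * Suc i mod p = q + q * i mod p"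
proof -
  have "p * deg i + p * (q * i div p) = p * (q * Suc i div p)"
    using div_le_div_Suc[of i] by (simp add: deg_def flip: distrib_left)
  moreover have "p * (q * Suc i div p) + q * Suc i mod p = q * Suc i" by simp
  moreover have "p * (q * i div p) + q * i mod p = q * i" by simp
  moreover have "q * Suc i = q * i + q" by simp
  ultimately show ?thesis by linarith
qed

text \<open>Relations inside a set with chain indices \<open>I\<close> are charged to their latest
  chain point: \<open>i\<close> receives its spokes, and its link only if the preceding chain point
  is present. The predecessor of \<open>0\<close> is \<open>w 0\<close>, whose presence is
  granted.\<close>

definition edge_bound :: "nat set \<Rightarrow> nat \<Rightarrow> nat" where
  "edge_bound I t = (\<Sum>i<t. if i \<in> I then deg i - 1 + (if i = 0 \<or> i - 1 \<in> I then 1 else 0) else 0)"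

text \<open>As \<open>deg\<close> is a balanced sequence, the invariant leaves a slack of \<open>q * t mod p < p\<close> at the right end
  of a block of consecutive indices; each later block loses one link and can afford this slack.\<close>

lemma edge_bound_le_aux:
  "p * edge_bound I t + (if t = 0 \<or> t - 1 \<in> I then q * t mod p else 0) \<le> q * card (I \<inter> {..<t})"
proof (induction t)
  case 0
  then show ?case by (simp add: edge_bound_def)
next
  case (Suc t)
  have pd: "p * deg t + q * Suc t mod p = q + q * t mod p" by (rule p_deg)
  have pd': "p * (deg t - 1) + p = p * deg t" using deg_pos[of t] by (cases "deg t") auto
  have m: "q * t mod p < p" using p_pos by simp
  have c: "card (I \<inter> {..<Suc t}) = card (I \<inter> {..<t}) + (if t \<in> I then 1 else 0)"
    by (auto simp: lessThan_Suc Int_insert_right)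
  have e: "edge_bound I (Suc t) = edge_bound I t +
     (if t \<in> I then deg t - 1 + (if t = 0 \<or> t - 1 \<in> I then 1 else 0) else 0)"
    by (simp add: edge_bound_def)
  show ?case
  proof (cases "t \<in> I")
    case False
    then show ?thesis using Suc c e by simp
  next
    case True
    then show ?thesis using Suc c e pd pd' m by (cases "t = 0 \<or> t - 1 \<in> I") (simp_all add: algebra_simps)
  qed
qed

lemma edge_bound_le:
  assumes "I \<subseteq> {..<t}"
  shows "p * edge_bound I t \<le> q * card I"
proof -
  have "I \<inter> {..<t} = I" using assms by blast
  then show ?thesis using edge_bound_le_aux[of I t] by simp
qed

section \<open>Counting the relations of a gadget inside a set\<close>

lemma spokes_finite [simp]: "finite (spokes w z i)"
  by (simp add: spokes_def)

lemma gadget_finite [simp]: "finite (gadget w v z)"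
  by (simp add: gadget_def)

lemma card_spokes: "card (spokes w z i) \<le> deg i - 1"
  unfolding spokes_def using card_image_le[of "{1..<deg i}"] by fastforce

text \<open>Charging each relation to its latest chain point leaves at most what
  \<open>edge_bound\<close> counts. Points are counted by their indices, so the estimate holds for
  arbitrary tuples.\<close>

lemma card_gadget_Int_le:
  fixes v w z :: "nat \<Rightarrow> 'a"
  defines "I \<equiv> \<lambda>Y. {i. i < 4 * p \<and> z i \<in> Y}"
  shows "p * card (gadget w v z \<inter> Pow Y) \<le> q * card (I Y)"
proof -
  define E where "E i = (if i = 0 \<or> i - 1 \<in> I Y then {link w v z i} else {}) \<union> spokes w z i" for i
  have fin: "finite (I Y)" by (simp add: I_def)
  have "gadget w v z \<inter> Pow Y \<subseteq> (\<Union>i \<in> I Y. E i)"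
    by (auto simp: gadget_def E_def I_def link_def spokes_def split: if_splits)
  then have "card (gadget w v z \<inter> Pow Y) \<le> card (\<Union>i \<in> I Y. E i)"
    using fin by (intro card_mono) (auto simp: E_def)
  also have "\<dots> \<le> (\<Sum>i \<in> I Y. card (E i))" using fin by (rule card_UN_le)
  also have "\<dots> \<le> (\<Sum>i \<in> I Y. deg i - 1 + (if i = 0 \<or> i - 1 \<in> I Y then 1 else 0))"
  proof (rule sum_mono)
    fix i
    have "card (E i) \<le> card (if i = 0 \<or> i - 1 \<in> I Y then {link w v z i} else {}) + card (spokes w z i)"
      unfolding E_def by (rule card_Un_le)
    then show "card (E i) \<le> deg i - 1 + (if i = 0 \<or> i - 1 \<in> I Y then 1 else 0)"
      using card_spokes[of w z i] by (auto split: if_splits)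
  qed
  also have "\<dots> = edge_bound (I Y) (4 * p)"
    unfolding edge_bound_def by (rule sum.mono_neutral_cong_left) (auto simp: I_def)
  finally have "p * card (gadget w v z \<inter> Pow Y) \<le> p * edge_bound (I Y) (4 * p)" by simp
  also have "\<dots> \<le> q * card (I Y)" by (rule edge_bound_le) (auto simp: I_def)
  finally show ?thesis .
qed

text \<open>Without \<open>w 0\<close> no spoke survives, and the link at the smallest index in
  \<open>I Y\<close> lacks its predecessor. Thus there are fewer relations than indices, and p \<le>
  q gives the weighted inequality.\<close>

lemma card_gadget_Int_less:
  fixes v w z :: "nat \<Rightarrow> 'a"
  defines "I \<equiv> \<lambda>Y. {i. i < 4 * p \<and> z i \<in> Y}"
  assumes "w 0 \<notin> Y" "I Y \<noteq> {}"
  shows "p * card (gadget w v z \<inter> Pow Y) < q * card (I Y)"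
proof -
  have fin: "finite (I Y)" by (simp add: I_def)
  have "gadget w v z \<inter> Pow Y \<subseteq> link w v z ` (I Y - {Min (I Y)})"
  proof
    fix t assume t: "t \<in> gadget w v z \<inter> Pow Y"
    then obtain i where i: "i < 4 * p" "t = link w v z i \<or> t \<in> spokes w z i"
      by (auto simp: gadget_def)
    have tl: "t = link w v z i" using i t assms(2) by (auto simp: spokes_def)
    have "i \<noteq> 0"
    proof
      assume "i = 0"
      then have "w 0 \<in> t" using tl by (simp add: link_def)
      then show False using t assms(2) by blast
    qed
    then have "i - 1 \<in> I Y" "i \<in> I Y" using tl t i by (auto simp: link_def I_def)
    then have "Min (I Y) \<le> i - 1" using fin by simp
    then have "i \<noteq> Min (I Y)" using \<open>i \<noteq> 0\<close> by simp
    then show "t \<in> link w v z ` (I Y - {Min (I Y)})" using tl \<open>i \<in> I Y\<close> by blast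
  qed
  then have "card (gadget w v z \<inter> Pow Y) \<le> card (link w v z ` (I Y - {Min (I Y)}))"
    using fin by (intro card_mono) auto
  also have "\<dots> \<le> card (I Y - {Min (I Y)})" using fin by (intro card_image_le) simp
  also have "\<dots> < card (I Y)" using fin assms(3) by (intro card_Diff1_less) auto
  finally have lt: "card (gadget w v z \<inter> Pow Y) < card (I Y)" .
  have "p * card (gadget w v z \<inter> Pow Y) \<le> q * card (gadget w v z \<inter> Pow Y)"
    using p_le_q by simp
  also have "\<dots> < q * card (I Y)" using lt q_pos by simp
  finally show ?thesis .
qed

text \<open>A relation determines its latest chain point, so the groups \<open>E i\<close> are
  disjoint and their sizes \<open>deg i\<close> add up to the floor of q * 4p / p.\<close>

lemma card_gadget:
  assumes "apart w v z"
  shows "card (gadget w v z) = 4 * q"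
proof -
  define E where "E i = insert (link w v z i) (spokes w z i)" for i
  have winj: "w i = w j \<longleftrightarrow> i = j" if "i \<le> q" "j \<le> q" for i j
    using assms that unfolding apart_def by auto
  have zinj: "z i = z j \<longleftrightarrow> i = j" if "i < 4 * p" "j < 4 * p" for i j
    using assms that unfolding apart_def by auto
  have zv: "z i \<noteq> v j" if "i < 4 * p" "j < 4 * p" for i j
    using assms that unfolding apart_def by auto
  have zw: "z i \<noteq> w j" "v i \<noteq> w j" if "i < 4 * p" "j \<le> q" for i j
    using assms that unfolding apart_def by auto
  have lq: "l \<le> q" if "l < deg i" for i l using that deg_le[of i] by simp
  have cE: "card (E i) = deg i" if i: "i < 4 * p" for i
  proof -
    have "inj_on (\<lambda>l. {z i, w 0, w l}) {1..<deg i}"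
    proof (rule inj_onI)
      fix a b assume ab: "a \<in> {1..<deg i}" "b \<in> {1..<deg i}" "{z i, w 0, w a} = {z i, w 0, w b}"
      then have "w a \<in> {z i, w 0, w b}" by blast
      moreover have "a \<le> q" "b \<le> q" "a \<noteq> 0" using ab(1,2) lq by auto
      moreover from this have "w a \<noteq> z i" "w a \<noteq> w 0" using zw(1)[OF i, of a] winj[of a 0] by auto
      ultimately show "a = b" using winj by blast
    qed
    then have "card (spokes w z i) = deg i - 1" by (simp add: spokes_def card_image)
    \<comment> \<open>The link contains \<open>v i\<close>, which \<open>apart\<close> keeps away
      from \<open>z i\<close> and from the base points.\<close>
    moreover have "link w v z i \<notin> spokes w z i"
    proof
      assume "link w v z i \<in> spokes w z i"
      then obtain l where l: "l < deg i" "link w v z i = {z i, w 0, w l}" by (auto simp: spokes_def)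
      then have "v i \<in> {z i, w 0, w l}" by (auto simp: link_def)
      then show False using zv[OF i i] zw[OF i] lq[OF l(1)] by force
    qed
    ultimately show ?thesis using deg_pos[of i] by (simp add: E_def)
  qed
  have top: "z j \<notin> t" if "t \<in> E i" "i < j" "j < 4 * p" for i j t
  proof -
    have "z j \<notin> {z i, w l, z (i - 1), v i}" if "l \<le> q" for l
      using zinj[of j i] zinj[of j "i - 1"] zv[of j i] zw(1)[OF \<open>j < 4 * p\<close> that] \<open>i < j\<close> \<open>j < 4 * p\<close>
      by auto
    then show ?thesis using that(1) lq[of _ i]
      unfolding E_def link_def spokes_def by (force split: if_splits)
  qed
  have mem: "z i \<in> t" if "t \<in> E i" for i t
    using that by (auto simp: E_def link_def spokes_def)
  have disj: "E i \<inter> E j = {}" if "i < 4 * p" "j < 4 * p" "i \<noteq> j" for i j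
    using top[of _ i j] top[of _ j i] mem[of _ i] mem[of _ j] that by (meson disjoint_iff linorder_neqE_nat)
  have "card (gadget w v z) = card (\<Union>i \<in> {..<4 * p}. E i)" by (simp add: gadget_def E_def)
  also have "\<dots> = (\<Sum>i<4 * p. card (E i))"
    using disj by (intro card_UN_disjoint) (auto simp: E_def)
  also have "\<dots> = (\<Sum>i<4 * p. deg i)" using cE by simp
  also have "\<dots> = 4 * q" using p_pos sum_deg[of "4 * p"] by (simp add: mult.left_commute)
  finally show ?thesis .
qed

lemma uniform3_gadget:
  assumes "apart w v z"
  shows "uniform3 (gadget w v z)"
  unfolding uniform3_def
proof
  fix t assume "t \<in> gadget w v z"
  then obtain i where i: "i < 4 * p" "t = link w v z i \<or> t \<in> spokes w z i"
    by (auto simp: gadget_def)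
  have zz: "z i \<noteq> z (i - 1)" if "i \<noteq> 0"
    using assms i(1) that unfolding apart_def by (metis (no_types) diff_less lessThan_iff less_imp_diff_less
      less_numeral_extra(1) nat_neq_iff neq0_conv)
  have zv: "z i \<noteq> v i" "z (i - 1) \<noteq> v i" using assms i(1) unfolding apart_def by auto
  have zw: "z i \<noteq> w l" "v i \<noteq> w l" if "l \<le> q" for l
    using assms i(1) that unfolding apart_def by auto
  have ww: "w 0 \<noteq> w l" if "l \<noteq> 0" "l \<le> q" for l
    using assms that unfolding apart_def by auto
  show "card t = 3"
  proof (cases "t = link w v z i")
    case True
    then show ?thesis using zz zv zw[of 0] by (auto simp: link_def card_insert_if)
  next
    case False
    then obtain l where l: "l \<in> {1..<deg i}" "t = {z i, w 0, w l}"
      using i(2) unfolding spokes_def by blast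
    then show ?thesis using ww[of l] zw(1)[of l] zw(1)[of 0] deg_le[of i] by (auto simp: card_insert_if)
  qed
qed

lemma gadget_cong:
  assumes "\<And>i. i < 4 * p \<Longrightarrow> v i = v' i"
  shows "gadget w v z = gadget w v' z"
  unfolding gadget_def by (intro SUP_cong refl) (simp add: link_def assms)

lemma apart_cong:
  assumes "\<And>i. i < 4 * p \<Longrightarrow> v i = v' i"
  shows "apart w v z = apart w v' z"
  unfolding apart_def using assms by auto

lemma gadget_image: "gadget (g \<circ> w) (g \<circ> v) (g \<circ> z) = (`) g ` gadget w v z"
proof -
  have "link (g \<circ> w) (g \<circ> v) (g \<circ> z) i = g ` link w v z i" for i by (simp add: link_def)
  moreover have "spokes (g \<circ> w) (g \<circ> z) i = (`) g ` spokes w z i" for i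
    by (simp add: spokes_def image_image)
  ultimately show ?thesis by (simp add: gadget_def image_UN)
qed

lemma gadget_subset_Pow:
  assumes "w ` {..q} \<subseteq> Y" "v ` {..<4 * p} \<subseteq> Y" "z ` {..<4 * p} \<subseteq> Y"
  shows "gadget w v z \<subseteq> Pow Y"
proof
  fix t assume "t \<in> gadget w v z"
  then obtain i where i: "i < 4 * p" "t = link w v z i \<or> t \<in> spokes w z i"
    by (auto simp: gadget_def)
  have "w l \<in> Y" if "l < deg i" for l using assms(1) that deg_le[of i] by auto
  moreover have "w 0 \<in> Y" "z i \<in> Y" "v i \<in> Y" "z (i - 1) \<in> Y" using assms i(1) by auto
  ultimately show "t \<in> Pow Y" using i(2) by (auto simp: link_def spokes_def)
qed

section \<open>Gadgets over strong sets\<close>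

abbreviation "\<alpha> \<equiv> real p / real q"

lemma alpha_le_iff: "\<alpha> * real a \<le> real b \<longleftrightarrow> p * a \<le> q * b"
proof -
  have "\<alpha> * real a \<le> real b \<longleftrightarrow> real (p * a) \<le> real (q * b)"
    using q_pos by (simp add: field_simps)
  then show ?thesis by (simp only: of_nat_le_iff)
qed

lemma alpha_less_iff: "\<alpha> * real a < real b \<longleftrightarrow> p * a < q * b"
proof -
  have "\<alpha> * real a < real b \<longleftrightarrow> real (p * a) < real (q * b)"
    using q_pos by (simp add: field_simps)
  then show ?thesis by (simp only: of_nat_less_iff)
qed

text \<open>The indices in \<open>I\<close> are those of points already in \<open>B\<close>. The
  others add 4p - card I points and at least 4q relations minus those of the gadget inside
  \<open>B\<close>, which weigh at most card I. So the predimension does not rise, which a closed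
  set forbids for a proper extension.\<close>

lemma gadget_in_closed:
  assumes B: "hclosed \<alpha> H U B" and ap: "apart w v z" and g: "gadget w v z \<subseteq> H"
    and w: "w ` {..q} \<subseteq> B" and v: "v ` {..<4 * p} \<subseteq> B" and z: "z ` {..<4 * p} \<subseteq> U"
  shows "z ` {..<4 * p} \<subseteq> B"
proof (rule ccontr)
  assume no: "\<not> z ` {..<4 * p} \<subseteq> B"
  let ?Y = "B \<union> z ` {..<4 * p}"
  define I where "I = {i. i < 4 * p \<and> z i \<in> B}"
  have fB: "finite B" and BU: "B \<subseteq> U" using B by (auto simp: hclosed_def)
  have zinj: "inj_on z {..<4 * p}" using ap unfolding apart_def inj_on_def by blast
  have IJ: "I \<subseteq> {..<4 * p}" by (auto simp: I_def)
  have "hstrong \<alpha> H B ?Y" using B fB BU z by (auto simp: hclosed_def)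
  then have less: "hdim \<alpha> H B < hdim \<alpha> H ?Y" using no unfolding hstrong_def by blast
  have "?Y = B \<union> z ` ({..<4 * p} - I)" by (auto simp: I_def)
  moreover have "B \<inter> z ` ({..<4 * p} - I) = {}" by (auto simp: I_def)
  ultimately have "card ?Y = card B + card (z ` ({..<4 * p} - I))"
    using fB by (simp add: card_Un_disjoint)
  also have "card (z ` ({..<4 * p} - I)) = card ({..<4 * p} - I)"
    using zinj by (intro card_image) (auto intro: inj_on_subset)
  also have "\<dots> = 4 * p - card I" using IJ by (simp add: card_Diff_subset finite_subset[OF IJ])
  finally have cY: "card ?Y = card B + (4 * p - card I)" .
  have cI: "card I \<le> 4 * p" using card_mono[OF _ IJ] by simp
  have gY: "gadget w v z \<subseteq> Pow ?Y"
    using w v by (intro gadget_subset_Pow) auto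
  have "card (gadget w v z) = card (gadget w v z \<inter> Pow B) + card (gadget w v z - Pow B)"
    by (metis card_Un_disjoint Int_Diff_Un Int_Diff_disjoint finite_Diff finite_Int gadget_finite)
  moreover have "card (H \<inter> Pow B) + card (gadget w v z - Pow B) \<le> card (H \<inter> Pow ?Y)"
  proof -
    have "card (H \<inter> Pow B) + card (gadget w v z - Pow B)
        = card (H \<inter> Pow B \<union> (gadget w v z - Pow B))"
      using fB by (intro card_Un_disjoint[symmetric]) auto
    also have "\<dots> \<le> card (H \<inter> Pow ?Y)" using fB g gY by (intro card_mono) auto
    finally show ?thesis .
  qed
  ultimately have "card (H \<inter> Pow B) + 4 * q \<le> card (H \<inter> Pow ?Y) + card (gadget w v z \<inter> Pow B)"
    using card_gadget[OF ap] by simp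
  then have "\<alpha> * (real (card (H \<inter> Pow B)) + 4 * real q)
      \<le> \<alpha> * (real (card (H \<inter> Pow ?Y)) + real (card (gadget w v z \<inter> Pow B)))"
    by (intro mult_left_mono) auto
  moreover have "\<alpha> * real (card (gadget w v z \<inter> Pow B)) \<le> real (card I)"
    using card_gadget_Int_le[of w v z B] by (simp only: alpha_le_iff I_def)
  moreover have "\<alpha> * (4 * real q) = 4 * real p" using q_pos by simp
  ultimately have "4 * real p - real (card I)
      \<le> \<alpha> * real (card (H \<inter> Pow ?Y)) - \<alpha> * real (card (H \<inter> Pow B))"
    by (simp only: distrib_left)
  then have "hdim \<alpha> H ?Y \<le> hdim \<alpha> H B"
    using cY cI by (simp add: hdim_def of_nat_diff)
  then show False using less by simp
qed

text \<open>Relations are bounded gadget by gadget, and strictness has two sources. A base point in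
  \<open>D\<close> adds 1, as relations are charged to chain points only. If \<open>D\<close> has no
  base point, then \<open>w 0\<close> is missing and some nonempty part of a gadget has positive
  predimension.\<close>

lemma gadget_extension_strong:
  fixes w :: "nat \<Rightarrow> 'a" and v z :: "nat \<Rightarrow> nat \<Rightarrow> 'a"
  defines "Y \<equiv> \<lambda>B m. B \<union> w ` {..q} \<union> (\<Union>j<m. z j ` {..<4 * p})"
  assumes B: "finite B" and wB: "w ` {..q} \<inter> B = {}" and winj: "inj_on w {..q}"
    and zB: "\<And>j i. j < m \<Longrightarrow> i < 4 * p \<Longrightarrow> z j i \<notin> B \<union> w ` {..q}"
    and zinj: "\<And>j i j' i'. j < m \<Longrightarrow> i < 4 * p \<Longrightarrow> j' < m \<Longrightarrow> i' < 4 * p \<Longrightarrow>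
      z j i = z j' i' \<Longrightarrow> j = j' \<and> i = i'"
  shows "hstrong \<alpha> (H \<inter> Pow B \<union> (\<Union>j<m. gadget w (v j) (z j))) B (Y B m)"
  unfolding hstrong_def
proof (intro conjI allI impI)
  let ?H = "H \<inter> Pow B \<union> (\<Union>j<m. gadget w (v j) (z j))"
  show "finite (Y B m)" "B \<subseteq> Y B m" using B by (auto simp: Y_def)
  fix D assume BD: "B \<subset> D" and DY: "D \<subseteq> Y B m"
  have fD: "finite D" using DY \<open>finite (Y B m)\<close> finite_subset by blast
  define I where "I j = {i. i < 4 * p \<and> z j i \<in> D}" for j
  define W where "W = D \<inter> w ` {..q}"
  define g where "g j = card (gadget w (v j) (z j) \<inter> Pow D)" for j
  have Ilt: "i < 4 * p" if "i \<in> I j" for i j using that by (simp add: I_def)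
  have Deq: "D = B \<union> W \<union> (\<Union>j<m. z j ` I j)"
    using BD DY by (auto simp: Y_def W_def I_def)
  have cD: "card D = card B + card W + (\<Sum>j<m. card (I j))"
  proof -
    have "finite (z j ` I j)" for j by (simp add: I_def)
    moreover have "z j ` I j \<inter> z j' ` I j' = {}" if "j < m" "j' < m" "j \<noteq> j'" for j j'
      using that zinj Ilt by blast
    ultimately have "card (\<Union>j<m. z j ` I j) = (\<Sum>j<m. card (z j ` I j))"
      by (intro card_UN_disjoint) simp_all
    also have "\<dots> = (\<Sum>j<m. card (I j))"
    proof (rule sum.cong)
      fix j assume "j \<in> {..<m}"
      then have "inj_on (z j) (I j)" using zinj Ilt by (intro inj_onI) blast
      then show "card (z j ` I j) = card (I j)" by (rule card_image)
    qed simp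
    finally have *: "card (\<Union>j<m. z j ` I j) = (\<Sum>j<m. card (I j))" .
    have "(B \<union> W) \<inter> (\<Union>j<m. z j ` I j) = {}" using zB Ilt by (auto simp: W_def)
    moreover have "B \<inter> W = {}" using wB by (auto simp: W_def)
    moreover have "finite W" by (simp add: W_def)
    moreover have "finite (\<Union>j<m. z j ` I j)" by (auto simp: I_def)
    ultimately have "card (B \<union> W \<union> (\<Union>j<m. z j ` I j)) = card B + card W + card (\<Union>j<m. z j ` I j)"
      using B by (simp add: card_Un_disjoint)
    then show ?thesis using * Deq by simp
  qed
  \<comment> \<open>Every relation of a gadget contains one of its new points.\<close>
  have notB: "\<not> t \<subseteq> B" if "j < m" "t \<in> gadget w (v j) (z j)" for j t
    using that zB by (fastforce simp: gadget_def link_def spokes_def)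
  have HB: "?H \<inter> Pow B = H \<inter> Pow B" using notB by auto
  have "card (?H \<inter> Pow D) \<le> card (H \<inter> Pow B \<union> (\<Union>j<m. gadget w (v j) (z j) \<inter> Pow D))"
    using B by (intro card_mono) auto
  also have "\<dots> \<le> card (H \<inter> Pow B) + card (\<Union>j<m. gadget w (v j) (z j) \<inter> Pow D)"
    by (rule card_Un_le)
  also have "\<dots> \<le> card (H \<inter> Pow B) + (\<Sum>j<m. g j)"
    unfolding g_def by (intro add_left_mono card_UN_le) simp
  finally have cH: "card (?H \<inter> Pow D) \<le> card (H \<inter> Pow B) + (\<Sum>j<m. g j)" .
  have le: "p * g j \<le> q * card (I j)" for j
    unfolding g_def I_def by (rule card_gadget_Int_le)
  have strict: "p * (\<Sum>j<m. g j) < q * (card W + (\<Sum>j<m. card (I j)))"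
  proof (cases "W = {}")
    case False
    then have "0 < card W" by (simp add: W_def card_gt_0_iff)
    moreover have "p * (\<Sum>j<m. g j) \<le> q * (\<Sum>j<m. card (I j))"
      using le by (simp add: sum_distrib_left sum_mono)
    moreover have "0 < q * card W" using q_pos \<open>0 < card W\<close> by simp
    ultimately show ?thesis by (simp only: distrib_left)
  next
    case True
    then have w0: "w 0 \<notin> D" by (auto simp: W_def)
    obtain j where j: "j < m" "I j \<noteq> {}" using BD Deq True by auto
    have "(\<Sum>j<m. p * g j) < (\<Sum>j<m. q * card (I j))"
    proof (rule sum_strict_mono_ex1)
      show "\<exists>j \<in> {..<m}. p * g j < q * card (I j)"
        using card_gadget_Int_less[of w D "z j" "v j"] w0 j unfolding g_def I_def by blast
    qed (use le in auto)
    then show ?thesis using True by (simp add: sum_distrib_left)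
  qed
  then have "\<alpha> * real (\<Sum>j<m. g j) < real (card W + (\<Sum>j<m. card (I j)))"
    by (simp only: alpha_less_iff)
  moreover have "\<alpha> * real (card (?H \<inter> Pow D)) \<le> \<alpha> * real (card (H \<inter> Pow B) + (\<Sum>j<m. g j))"
    using cH by (intro mult_left_mono) (simp_all only: of_nat_le_iff, simp)
  ultimately show "hdim \<alpha> ?H B < hdim \<alpha> ?H D"
    unfolding hdim_def HB cD by (simp add: distrib_left)
qed

text \<open>A link contains its entry \<open>v' i\<close> from \<open>B\<close>, whereas spokes
  avoid \<open>B\<close>; so a link not inside \<open>B\<close> is a link of a given gadget. Links
  through \<open>w 0\<close> are first links. From there each chain point lies on at most two links,
  and since the chain cannot turn back, it follows the given one to the end.\<close>

lemma gadget_unique: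
  fixes w :: "nat \<Rightarrow> 'a" and v z :: "nat \<Rightarrow> nat \<Rightarrow> 'a"
  assumes wB: "w ` {..q} \<inter> B = {}"
    and zB: "\<And>j i. j < m \<Longrightarrow> i < 4 * p \<Longrightarrow> z j i \<notin> B \<union> w ` {..q}"
    and zinj: "\<And>j i j' i'. j < m \<Longrightarrow> i < 4 * p \<Longrightarrow> j' < m \<Longrightarrow> i' < 4 * p \<Longrightarrow>
      z j i = z j' i' \<Longrightarrow> j = j' \<and> i = i'"
    and vB: "\<And>j i. j < m \<Longrightarrow> i < 4 * p \<Longrightarrow> v j i \<in> B"
    and sub: "gadget w v' z' \<subseteq> Pow B \<union> (\<Union>j<m. gadget w (v j) (z j))"
    and ap: "apart w v' z'" and v'B: "v' ` {..<4 * p} \<subseteq> B"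
  obtains j where "j < m" "\<And>i. i < 4 * p \<Longrightarrow> z' i = z j i \<and> v' i = v j i"
proof -
  have z'inj: "z' i = z' j \<longleftrightarrow> i = j" if "i < 4 * p" "j < 4 * p" for i j
    using ap that unfolding apart_def by auto
  have z'v: "z' i \<noteq> v' j" if "i < 4 * p" "j < 4 * p" for i j
    using ap that unfolding apart_def by auto
  have z'w: "z' i \<noteq> w j" "v' i \<noteq> w j" if "i < 4 * p" "j \<le> q" for i j
    using ap that unfolding apart_def by auto
  have v'i: "v' i \<in> B" if "i < 4 * p" for i using v'B that by auto
  have wl: "w l \<notin> B" if "l \<le> q" for l using wB that by auto
  have w0: "w 0 \<notin> B" using wl by simp
  have lnk: "\<exists>j i'. j < m \<and> i' < 4 * p \<and> link w v' z' i = link w (v j) (z j) i'"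
    if i: "i < 4 * p" and nB: "\<not> link w v' z' i \<subseteq> B" for i
  proof -
    have "link w v' z' i \<in> gadget w v' z'" using i by (auto simp: gadget_def)
    then have "link w v' z' i \<in> (\<Union>j<m. gadget w (v j) (z j))" using sub nB by blast
    then obtain j i' where j: "j < m" "i' < 4 * p"
      "link w v' z' i = link w (v j) (z j) i' \<or> link w v' z' i \<in> spokes w (z j) i'"
      unfolding gadget_def by blast
    have "link w v' z' i \<notin> spokes w (z j) i'"
    proof
      assume "link w v' z' i \<in> spokes w (z j) i'"
      then obtain l where l: "l < deg i'" "link w v' z' i = {z j i', w 0, w l}"
        by (auto simp: spokes_def)
      have "v' i \<in> {z j i', w 0, w l}" using l(2) by (auto simp: link_def)
      moreover have "w l \<notin> B" using l(1) deg_le[of i'] by (intro wl) simp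
      ultimately show False using v'i[OF i] w0 zB[OF j(1,2)] by auto
    qed
    then show ?thesis using j by blast
  qed
  have vmatch: "v' i = v j i'" if "i < 4 * p" "j < m" "i' < 4 * p"
    "link w v' z' i = link w (v j) (z j) i'" for i j i'
  proof -
    have "v' i \<in> link w (v j) (z j) i'" using that(4) by (auto simp: link_def)
    then show ?thesis
      using v'i[OF that(1)] w0 zB[OF that(2,3)] zB[OF that(2), of "i' - 1"] that(3)
      by (auto simp: link_def split: if_splits)
  qed
  have p4: "0 < 4 * p" using p_pos by simp
  have "\<not> link w v' z' 0 \<subseteq> B" using w0 by (auto simp: link_def)
  then obtain j i' where j: "j < m" "i' < 4 * p" "link w v' z' 0 = link w (v j) (z j) i'"
    using lnk[OF p4] by blast
  have v0: "v' 0 = v j i'" using vmatch[OF p4 j] .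
  have "w 0 \<in> link w (v j) (z j) i'" using j(3) by (auto simp: link_def)
  moreover have "w 0 \<in> w ` {..q}" by simp
  then have "w 0 \<noteq> z j k" if "k < 4 * p" for k using zB[OF j(1) that] by (metis UnCI \<open>w 0 \<in> w ` {..q}\<close>)
  \<comment> \<open>For \<open>i' > 0\<close> the link would consist of two new points and an entry
    in \<open>B\<close>, none of them equal to \<open>w 0\<close>.\<close>
  ultimately have i'0: "i' = 0"
    using zB[OF j(1,2)] zB[OF j(1), of "i' - 1"] j(2) vB[OF j(1,2)] w0
    by (auto simp: link_def split: if_splits)
  have "z' 0 \<in> link w (v j) (z j) 0" using j(3) i'0 by (auto simp: link_def)
  then have z0: "z' 0 = z j 0"
    using z'w(1)[OF p4, of 0] z'v[OF p4 p4] v0 i'0 by (auto simp: link_def)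
  have "z' i = z j i \<and> v' i = v j i" if "i < 4 * p" for i
    using that
  proof (induction i rule: less_induct)
    case (less i)
    show ?case
    proof (cases "i = 0")
      case True
      then show ?thesis using z0 v0 i'0 by simp
    next
      case False
      then have i: "i < 4 * p" "i - 1 < 4 * p" "z' (i - 1) = z j (i - 1)"
        using less by auto
      have zm: "z' (i - 1) \<in> link w v' z' i" using False by (simp add: link_def)
      then have "\<not> link w v' z' i \<subseteq> B" using i zB[OF j(1) i(2)] by auto
      then obtain j' k where k: "j' < m" "k < 4 * p" "link w v' z' i = link w (v j') (z j') k"
        using lnk[OF i(1)] by blast
      have vk: "v' i = v j' k" using vmatch[OF i(1) k] .
      have zm': "z j (i - 1) \<in> link w (v j') (z j') k" using zm i(3) k(3) by simp
      have zi: "z' i \<in> link w (v j') (z j') k" using k(3) by (auto simp: link_def)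
      have nw: "z j (i - 1) \<noteq> w 0" "z j (i - 1) \<noteq> v j' k"
        using zB[OF j(1) i(2)] vB[OF k(1,2)] by auto
      have zi_neq: "z' i \<noteq> v j' k" using z'v[OF i(1,1)] vk by simp
      consider "z j (i - 1) = z j' k" | "k \<noteq> 0" "z j (i - 1) = z j' (k - 1)"
        using zm' nw by (auto simp: link_def split: if_splits)
      then show ?thesis
      proof cases
        \<comment> \<open>The chain would turn back to the link at \<open>i - 1\<close>, and
          \<open>z' i\<close> would be \<open>w 0\<close> or \<open>z' (k - 1)\<close>;
          \<open>apart\<close> excludes both.\<close>
        case 1
        then have jk: "j' = j" "k = i - 1" using zinj[OF j(1) i(2) k(1,2)] by auto
        then have "z' i \<noteq> z j' k" using i z'inj[OF i(1,2)] False by simp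
        then have "z' i = (if k = 0 then w 0 else z j' (k - 1))"
          using zi zi_neq by (auto simp: link_def)
        then have "k \<noteq> 0" "z' i = z j (k - 1)" using z'w(1)[OF i(1), of 0] jk by (auto split: if_splits)
        moreover have "z' (k - 1) = z j (k - 1)" using less jk \<open>k \<noteq> 0\<close> by auto
        ultimately have "i = k - 1" using z'inj[of i "k - 1"] i(1) k(2) by auto
        then have False using jk(2) \<open>k \<noteq> 0\<close> by linarith
        then show ?thesis ..
      next
        case 2
        then have jk: "j' = j" "k - 1 = i - 1" using zinj[OF j(1) i(2) k(1), of "k - 1"] k(2) by auto
        then have ki: "k = i" using 2 False by simp
        have "z' i \<noteq> z j (i - 1)" using i z'inj[OF i(1,2)] False by simp
        then have "z' i = z j i" using zi zi_neq jk ki False by (auto simp: link_def)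
        then show ?thesis using vk jk ki by simp
      qed
    qed
  qed
  then show ?thesis using that j(1) by blast
qed

end

section \<open>Coding finite relations in the generic structure\<close>

text \<open>All indices from 3 on give \<open>d\<close>. Tuples are read below 4p \<ge> 4, so each
  of the four entries occurs.\<close>

definition quad :: "'a \<Rightarrow> 'a \<Rightarrow> 'a \<Rightarrow> 'a \<Rightarrow> nat \<Rightarrow> 'a" where
  "quad a b c d i = (if i = 0 then a else if i = 1 then b else if i = 2 then c else d)"

locale generic_slope = slope +
  fixes M :: "(hyp_sym, 'a::infinite) struct"
  assumes gen: "generic (real p / real q) M"
begin

lemma hyp_struct_M: "hyp_struct M"
  using gen by (simp add: generic_def class_pos_bar_def)

abbreviation "cl \<equiv> hclosed \<alpha> (edges M) (univ M)"

lemma exists_closed: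
  assumes "finite F" "F \<subseteq> univ M"
  obtains B where "F \<subseteq> B" "cl B"
  using generic_exists_closed[OF gen _ assms] by auto

text \<open>The configuration is built on names outside \<open>B\<close> and moved into
  \<open>M\<close> by \<open>generic_extension\<close>. Its image is closed, so every gadget over
  the new base points with entries in \<open>B\<close> lies inside the image, where all relations
  are known and \<open>gadget_unique\<close> applies.\<close>

lemma exists_gadgets:
  fixes v :: "nat \<Rightarrow> nat \<Rightarrow> 'a"
  assumes B: "cl B" and v: "\<And>j i. j < m \<Longrightarrow> i < 4 * p \<Longrightarrow> v j i \<in> B"
  obtains w z where "w ` {..q} \<subseteq> univ M - B" "inj_on w {..q}"
    and "\<And>j i. j < m \<Longrightarrow> i < 4 * p \<Longrightarrow> z j i \<in> univ M"
    and "\<And>j i j' i'. j < m \<Longrightarrow> i < 4 * p \<Longrightarrow> j' < m \<Longrightarrow> i' < 4 * p \<Longrightarrow>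
      z j i = z j' i' \<Longrightarrow> j = j' \<and> i = i'"
    and "\<And>j. j < m \<Longrightarrow> apart w (v j) (z j) \<and> gadget w (v j) (z j) \<subseteq> edges M"
    and "\<And>v' z'. apart w v' z' \<Longrightarrow> gadget w v' z' \<subseteq> edges M \<Longrightarrow> v' ` {..<4 * p} \<subseteq> B \<Longrightarrow>
      z' ` {..<4 * p} \<subseteq> univ M \<Longrightarrow> \<exists>j<m. \<forall>i<4 * p. z' i = z j i \<and> v' i = v j i"
proof -
  let ?H = "edges M"
  have fB: "finite B" using B by (simp add: hclosed_def)
  then have "infinite (- B)" by (simp add: infinite_UNIV)
  then obtain c :: "nat \<Rightarrow> 'a" where c: "inj c" "range c \<subseteq> - B"
    using infinite_countable_subset by blast
  \<comment> \<open>\<open>c 0\<close> to \<open>c q\<close> are reserved for the base points;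
    disjoint blocks of length 4p follow, one for each gadget.\<close>
  define z0 where "z0 j i = c (Suc q + (4 * p * j + i))" for j i
  define Y where "Y = B \<union> c ` {..q} \<union> (\<Union>j<m. z0 j ` {..<4 * p})"
  \<comment> \<open>Relations of \<open>M\<close> that involve names outside \<open>B\<close> are
    discarded.\<close>
  define H' where "H' = ?H \<inter> Pow B \<union> (\<Union>j<m. gadget c (v j) (z0 j))"
  have cB: "c i \<notin> B" for i using c(2) by auto
  have ceq: "c i = c j \<longleftrightarrow> i = j" for i j using c(1) by (simp add: inj_eq)
  have z0inj: "j = j' \<and> i = i'" if "i < 4 * p" "i' < 4 * p" "z0 j i = z0 j' i'" for j i j' i'
  proof -
    have eq: "4 * p * j + i = 4 * p * j' + i'" using that(3) by (simp add: z0_def ceq)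
    have "(4 * p * j + i) div (4 * p) = j" "(4 * p * j' + i') div (4 * p) = j'"
      using that(1,2) p_pos by auto
    then have "j = j'" using eq by metis
    then show ?thesis using eq by simp
  qed
  have z0c: "z0 j i \<noteq> c l" if "l \<le> q" for j i l using that by (simp add: z0_def ceq)
  have z0B: "z0 j i \<notin> B \<union> c ` {..q}" for j i using z0c cB by (auto simp: z0_def ceq)
  have ap0: "apart c (v j) (z0 j)" if "j < m" for j
    unfolding apart_def
  proof (intro conjI ballI impI)
    fix i l assume "i \<in> {..<4 * p}" "l \<in> {..q}"
    then show "z0 j i \<noteq> c l" "v j i \<noteq> c l" using z0c v[OF that, of i] cB by auto
  next
    fix i l assume il: "i \<in> {..<4 * p}" "l \<in> {..<4 * p}"
    then show "z0 j i \<noteq> v j l" using z0B[of j i] v[OF that, of l] by auto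
    show "i \<noteq> l \<Longrightarrow> z0 j i \<noteq> z0 j l" using z0inj[of i l j j] il by auto
  qed (simp add: ceq)
  have H: "uniform3 ?H" using hyp_struct_M by (rule uniform3_edges)
  have uni: "uniform3 H'"
    using uniform3_gadget[OF ap0] H by (auto simp: H'_def uniform3_def)
  have notB: "\<not> t \<subseteq> B" if "t \<in> gadget c (v j) (z0 j)" for j t
    using that z0B by (fastforce simp: gadget_def link_def spokes_def)
  have HB: "H' \<inter> Pow B = ?H \<inter> Pow B" using notB by (auto simp: H'_def)
  have "hstrong \<alpha> H' B Y"
    unfolding H'_def Y_def
    by (rule gadget_extension_strong) (use fB cB ceq z0B z0inj in \<open>auto intro: inj_onI\<close>)
  then obtain g where g: "inj_on g Y" "g ` Y \<subseteq> univ M" "\<And>a. a \<in> B \<Longrightarrow> g a = a"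
    "\<And>t. t \<subseteq> Y \<Longrightarrow> t \<in> H' \<longleftrightarrow> g ` t \<in> ?H" "cl (g ` Y)"
    using generic_extension[OF gen _ B uni HB] by auto
  define w where "w = g \<circ> c"
  define z where "z j = g \<circ> z0 j" for j
  have cY: "c i \<in> Y" if "i \<le> q" for i using that by (auto simp: Y_def)
  have zY: "z0 j i \<in> Y" if "j < m" "i < 4 * p" for j i using that by (auto simp: Y_def)
  have geq: "g a = g b \<longleftrightarrow> a = b" if "a \<in> Y" "b \<in> Y" for a b
    using g(1) that by (auto simp: inj_on_def)
  have BY: "B \<subseteq> Y" by (auto simp: Y_def)
  have gB: "g a \<notin> B" if "a \<in> Y" "a \<notin> B" for a
  proof
    assume "g a \<in> B"
    then have "g (g a) = g a" by (rule g(3))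
    then show False using geq[of "g a" a] that \<open>g a \<in> B\<close> BY by auto
  qed
  have gv: "gadget w (v j) (z j) = (`) g ` gadget c (v j) (z0 j)" if "j < m" for j
  proof -
    have "gadget w (v j) (z j) = gadget w (g \<circ> v j) (z j)"
      using v[OF that] g(3) by (intro gadget_cong) simp
    then show ?thesis by (simp add: w_def z_def gadget_image)
  qed
  have gadY: "gadget c (v j) (z0 j) \<subseteq> Pow Y" if "j < m" for j
    using that BY cY zY v[OF that] by (intro gadget_subset_Pow) auto
  have wU: "w ` {..q} \<subseteq> univ M - B" using g(2) cY gB cB by (auto simp: w_def)
  have winj: "inj_on w {..q}" using cY by (intro inj_onI) (simp add: w_def geq ceq)
  have zU: "z j i \<in> univ M" if "j < m" "i < 4 * p" for j i using zY[OF that] g(2) by (auto simp: z_def)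
  have zinj: "j = j' \<and> i = i'"
    if "j < m" "i < 4 * p" "j' < m" "i' < 4 * p" "z j i = z j' i'" for j i j' i'
    using that z0inj zY by (simp add: z_def geq)
  have zB: "z j i \<notin> B \<union> w ` {..q}" if "j < m" "i < 4 * p" for j i
    using gB[OF zY[OF that]] z0B[of j i] geq[OF zY[OF that] cY] z0c by (auto simp: z_def w_def)
  have ap: "apart w (v j) (z j)" if j: "j < m" for j
    unfolding apart_def
  proof (intro conjI ballI impI)
    fix i l assume "i \<in> {..<4 * p}" "l \<in> {..q}"
    then show "z j i \<noteq> w l" "v j i \<noteq> w l" using zB[OF j, of i] v[OF j, of i] wU by auto
  next
    fix i l assume il: "i \<in> {..<4 * p}" "l \<in> {..<4 * p}"
    then show "z j i \<noteq> v j l" using zB[OF j, of i] v[OF j, of l] by auto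
    show "i \<noteq> l \<Longrightarrow> z j i \<noteq> z j l" using zinj[of j i j l] il j by auto
  next
    fix i l assume "i \<in> {..q}" "l \<in> {..q}" "i \<noteq> l"
    then show "w i \<noteq> w l" using winj by (auto simp: inj_on_def)
  qed
  have sub: "gadget w (v j) (z j) \<subseteq> ?H" if jm: "j < m" for j
  proof
    fix t assume "t \<in> gadget w (v j) (z j)"
    then obtain s where s: "s \<in> gadget c (v j) (z0 j)" "t = g ` s" using gv[OF jm] by auto
    then have "s \<in> H'" "s \<subseteq> Y" using jm gadY[OF jm] by (auto simp: H'_def)
    then show "t \<in> ?H" using g(4) s(2) by blast
  qed
  have edge: "t \<in> Pow B \<union> (\<Union>j<m. gadget w (v j) (z j))" if t: "t \<in> ?H" "t \<subseteq> g ` Y" for t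
  proof -
    obtain s where s: "s \<subseteq> Y" "t = g ` s" using t(2) by (meson subset_imageE)
    then have "s \<in> H'" using g(4) t(1) by blast
    then consider "s \<subseteq> B" | j where "j < m" "s \<in> gadget c (v j) (z0 j)" by (auto simp: H'_def)
    then show ?thesis
    proof cases
      case 1
      then have "g ` s = s" using g(3) by force
      then show ?thesis using 1 s by simp
    next
      case 2
      then show ?thesis using gv s by blast
    qed
  qed
  have un: "\<exists>j<m. \<forall>i<4 * p. z' i = z j i \<and> v' i = v j i"
    if *: "apart w v' z'" "gadget w v' z' \<subseteq> ?H" "v' ` {..<4 * p} \<subseteq> B"
      "z' ` {..<4 * p} \<subseteq> univ M" for v' z'
  proof -
    have wY: "w ` {..q} \<subseteq> g ` Y" using cY by (auto simp: w_def)
    have BgY: "B \<subseteq> g ` Y" using BY g(3) by force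
    have vY: "v' ` {..<4 * p} \<subseteq> g ` Y" using *(3) BgY by blast
    have "z' ` {..<4 * p} \<subseteq> g ` Y" using gadget_in_closed[OF g(5) *(1,2) wY vY *(4)] .
    then have gY: "gadget w v' z' \<subseteq> Pow (g ` Y)" using wY vY by (intro gadget_subset_Pow)
    have sub': "gadget w v' z' \<subseteq> Pow B \<union> (\<Union>j<m. gadget w (v j) (z j))"
    proof
      fix t assume "t \<in> gadget w v' z'"
      then have "t \<in> ?H" "t \<subseteq> g ` Y" using *(2) gY by blast+
      then show "t \<in> Pow B \<union> (\<Union>j<m. gadget w (v j) (z j))" by (rule edge)
    qed
    have "w ` {..q} \<inter> B = {}" using wU by blast
    then show ?thesis
      using zB zinj v sub' *(1,3)
    proof (rule gadget_unique[of w B m z v v' z'])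
      fix j assume j: "j < m" "\<And>i. i < 4 * p \<Longrightarrow> z' i = z j i \<and> v' i = v j i"
      have "\<forall>i<4 * p. z' i = z j i \<and> v' i = v j i" using j(2) by simp
      then show ?thesis using j(1) by blast
    qed
  qed
  have apsub: "apart w (v j) (z j) \<and> gadget w (v j) (z j) \<subseteq> ?H" if "j < m" for j
    using ap sub that by blast
  show ?thesis using wU winj zU zinj apsub un by (rule that[of w z])
qed

section \<open>Codes, fibres and coded relations\<close>

definition code :: "(nat \<Rightarrow> 'a) \<Rightarrow> (nat \<Rightarrow> 'a) \<Rightarrow> 'a \<Rightarrow> bool" where
  "code w v x \<longleftrightarrow>
     (\<exists>z. (\<forall>i<4 * p. z i \<in> univ M) \<and> z 0 = x \<and> apart w v z \<and> gadget w v z \<subseteq> edges M)"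

definition fibre :: "(nat \<Rightarrow> 'a) \<Rightarrow> 'a \<Rightarrow> 'a set" where
  "fibre w b = {x. code w (quad b b b b) x}"

definition related :: "(nat \<Rightarrow> 'a) \<Rightarrow> 'a \<Rightarrow> 'a \<Rightarrow> 'a \<Rightarrow> 'a \<Rightarrow> bool" where
  "related w a b c d \<longleftrightarrow> (\<exists>x \<in> univ M. code w (quad a b c d) x)"

lemma code_in_closed:
  assumes "code w v x" "cl B" "w ` {..q} \<subseteq> B" "v ` {..<4 * p} \<subseteq> B"
  shows "x \<in> B"
proof -
  obtain z where z: "\<forall>i<4 * p. z i \<in> univ M" "z 0 = x" "apart w v z" "gadget w v z \<subseteq> edges M"
    using assms(1) by (auto simp: code_def)
  have "z ` {..<4 * p} \<subseteq> B"
    by (rule gadget_in_closed[OF assms(2) z(3,4) assms(3,4)]) (use z(1) in auto)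
  then show ?thesis using z(2) p_pos by auto
qed

lemma fibre_subset_closed:
  assumes "cl B" "w ` {..q} \<subseteq> B" "b \<in> B"
  shows "fibre w b \<subseteq> B"
proof
  fix x assume "x \<in> fibre w b"
  then have "code w (quad b b b b) x" by (simp add: fibre_def)
  moreover have "quad b b b b ` {..<4 * p} \<subseteq> B" using assms(3) by (auto simp: quad_def)
  ultimately show "x \<in> B" using code_in_closed assms(1,2) by blast
qed

lemma fibre_subset_univ: "fibre w b \<subseteq> univ M"
  using p_pos by (auto simp: fibre_def code_def)

lemma finite_fibre:
  assumes "w ` {..q} \<subseteq> univ M" "b \<in> univ M"
  shows "finite (fibre w b)"
proof -
  obtain B where "insert b (w ` {..q}) \<subseteq> B" "cl B"
    using exists_closed[of "insert b (w ` {..q})"] assms by auto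
  then show ?thesis
    using fibre_subset_closed[of B w b] by (auto simp: hclosed_def intro: finite_subset)
qed

lemma quad_eq_iff:
  "(\<forall>i<4 * p. quad a b c d i = quad a' b' c' d' i) \<longleftrightarrow> a = a' \<and> b = b' \<and> c = c' \<and> d = d'"
proof
  assume *: "\<forall>i<4 * p. quad a b c d i = quad a' b' c' d' i"
  have "0 < 4 * p" "1 < 4 * p" "2 < 4 * p" "3 < 4 * p" using p_pos by auto
  then have "quad a b c d i = quad a' b' c' d' i" if "i \<in> {0, 1, 2, 3}" for i
    using * that by blast
  from this[of 0] this[of 1] this[of 2] this[of 3]
  show "a = a' \<and> b = b' \<and> c = c' \<and> d = d'" by (simp add: quad_def)
qed simp

text \<open>A tuple may be listed in \<open>v\<close> several times. Each occurrence has its own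
  gadget, so the number of codes of a tuple is its multiplicity; this is how prescribed
  cardinalities arise.\<close>

lemma exists_code:
  fixes v :: "nat \<Rightarrow> nat \<Rightarrow> 'a"
  assumes B: "cl B" and v: "\<And>j i. j < m \<Longrightarrow> i < 4 * p \<Longrightarrow> v j i \<in> B"
  obtains w x where "w ` {..q} \<subseteq> univ M - B" "inj_on w {..q}" "inj_on x {..<m}"
    "\<And>j. j < m \<Longrightarrow> x j \<in> univ M"
    "\<And>v' y. v' ` {..<4 * p} \<subseteq> B \<Longrightarrow> code w v' y \<longleftrightarrow> (\<exists>j<m. (\<forall>i<4 * p. v' i = v j i) \<and> y = x j)"
proof -
  obtain w z where w: "w ` {..q} \<subseteq> univ M - B" "inj_on w {..q}"
    and zU: "\<And>j i. j < m \<Longrightarrow> i < 4 * p \<Longrightarrow> z j i \<in> univ M"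
    and zinj: "\<And>j i j' i'. j < m \<Longrightarrow> i < 4 * p \<Longrightarrow> j' < m \<Longrightarrow> i' < 4 * p \<Longrightarrow>
      z j i = z j' i' \<Longrightarrow> j = j' \<and> i = i'"
    and ap: "\<And>j. j < m \<Longrightarrow> apart w (v j) (z j) \<and> gadget w (v j) (z j) \<subseteq> edges M"
    and un: "\<And>v' z'. apart w v' z' \<Longrightarrow> gadget w v' z' \<subseteq> edges M \<Longrightarrow> v' ` {..<4 * p} \<subseteq> B \<Longrightarrow>
      z' ` {..<4 * p} \<subseteq> univ M \<Longrightarrow> \<exists>j<m. \<forall>i<4 * p. z' i = z j i \<and> v' i = v j i"
    by (rule exists_gadgets[OF B v]) blast+
  have p4: "0 < 4 * p" using p_pos by simp
  have "code w v' y \<longleftrightarrow> (\<exists>j<m. (\<forall>i<4 * p. v' i = v j i) \<and> y = z j 0)"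
    if v': "v' ` {..<4 * p} \<subseteq> B" for v' y
  proof
    assume "code w v' y"
    then obtain z' where z': "\<forall>i<4 * p. z' i \<in> univ M" "z' 0 = y" "apart w v' z'"
      "gadget w v' z' \<subseteq> edges M"
      by (auto simp: code_def)
    have "z' ` {..<4 * p} \<subseteq> univ M" using z'(1) by auto
    from un[OF z'(3,4) v' this] show "\<exists>j<m. (\<forall>i<4 * p. v' i = v j i) \<and> y = z j 0"
      using z'(2) p4 by auto
  next
    assume "\<exists>j<m. (\<forall>i<4 * p. v' i = v j i) \<and> y = z j 0"
    then obtain j where j: "j < m" "\<And>i. i < 4 * p \<Longrightarrow> v' i = v j i" "y = z j 0" by auto
    have "apart w v' (z j)" "gadget w v' (z j) \<subseteq> edges M"
      using ap[OF j(1)] apart_cong[of v' "v j" w "z j", OF j(2)]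
        gadget_cong[of v' "v j" w "z j", OF j(2)] by simp_all
    then show "code w v' y" using zU[OF j(1)] j(3) by (auto simp: code_def)
  qed
  moreover have "inj_on (\<lambda>j. z j 0) {..<m}" using zinj p4 by (intro inj_onI) blast
  ultimately show ?thesis using that[of w "\<lambda>j. z j 0"] w zU p4 by blast
qed

lemma exists_fibres:
  obtains w b b' where "w ` {..q} \<subseteq> univ M" "b \<in> univ M" "b' \<in> univ M"
    "card (fibre w b) = m" "card (fibre w b') = n"
proof -
  obtain B0 where B0: "cl B0" using exists_closed[of "{}"] by auto
  \<comment> \<open>The empty family yields base points alone; as q \<ge> 1, they include two
    distinct elements of \<open>M\<close>.\<close>
  obtain u :: "nat \<Rightarrow> 'a" where u: "u ` {..q} \<subseteq> univ M - B0" "inj_on u {..q}"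
    by (rule exists_code[OF B0, of 0 undefined]) auto
  have ne: "u 0 \<noteq> u 1" using inj_onD[OF u(2), of 0 1] q_pos by auto
  have "0 \<in> {..q}" "1 \<in> {..q}" using q_pos by auto
  then have uU: "u 0 \<in> univ M" "u 1 \<in> univ M" using u(1) by blast+
  then obtain B where B: "{u 0, u 1} \<subseteq> B" "cl B" using exists_closed[of "{u 0, u 1}"] by auto
  define v where "v j = (let a = if j < m then u 0 else u 1 in quad a a a a)" for j
  have "v j i \<in> B" for j i using B by (auto simp: v_def quad_def Let_def)
  then obtain w x where w: "w ` {..q} \<subseteq> univ M - B" and x: "inj_on x {..<m + n}"
    and code: "\<And>v' y. v' ` {..<4 * p} \<subseteq> B \<Longrightarrow>
      code w v' y \<longleftrightarrow> (\<exists>j<m + n. (\<forall>i<4 * p. v' i = v j i) \<and> y = x j)"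
    by (rule exists_code[OF B(2), of "m + n" v]) blast+
  have fib: "fibre w b = x ` {j. j < m + n \<and> b = (if j < m then u 0 else u 1)}" if "b \<in> B" for b
  proof -
    have "quad b b b b ` {..<4 * p} \<subseteq> B" using that by (auto simp: quad_def)
    then show ?thesis by (auto simp: fibre_def code v_def Let_def quad_eq_iff)
  qed
  have "{j. j < m + n \<and> u 0 = (if j < m then u 0 else u 1)} = {..<m}"
    "{j. j < m + n \<and> u 1 = (if j < m then u 0 else u 1)} = {m..<m + n}"
    using ne by (auto split: if_splits)
  then have "fibre w (u 0) = x ` {..<m}" "fibre w (u 1) = x ` {m..<m + n}"
    using fib B(1) by simp_all
  moreover have "inj_on x {..<m}" "inj_on x {m..<m + n}"
    by (rule inj_on_subset[OF x], force)+
  ultimately have "card (fibre w (u 0)) = m" "card (fibre w (u 1)) = n"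
    by (simp_all add: card_image)
  then show ?thesis using that[of w "u 0" "u 1"] w uU by blast
qed

lemma exists_related:
  assumes B: "cl B" and F: "F \<subseteq> B \<times> B \<times> B \<times> B"
  obtains u where "u ` {..q} \<subseteq> univ M"
    "\<And>a b c d. {a, b, c, d} \<subseteq> B \<Longrightarrow> related u a b c d \<longleftrightarrow> (a, b, c, d) \<in> F"
proof -
  have "finite B" using B by (simp add: hclosed_def)
  then have "finite F" using F by (meson finite_SigmaI finite_subset)
  then obtain h where h: "bij_betw h {0..<card F} F" using ex_bij_betw_nat_finite by blast
  define v where "v j = (case h j of (a, b, c, d) \<Rightarrow> quad a b c d)" for j
  have hF: "h j \<in> F" if "j < card F" for j using h that by (auto simp: bij_betw_def)
  have "v j i \<in> B" if "j < card F" for j i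
    using hF[OF that] F by (auto simp: v_def quad_def split: prod.splits)
  then obtain w x where w: "w ` {..q} \<subseteq> univ M - B" and xU: "\<And>j. j < card F \<Longrightarrow> x j \<in> univ M"
    and code: "\<And>v' y. v' ` {..<4 * p} \<subseteq> B \<Longrightarrow>
      code w v' y \<longleftrightarrow> (\<exists>j<card F. (\<forall>i<4 * p. v' i = v j i) \<and> y = x j)"
    by (rule exists_code[OF B, of "card F" v]) blast+
  have "related w a b c d \<longleftrightarrow> (a, b, c, d) \<in> F" if abcd: "{a, b, c, d} \<subseteq> B" for a b c d
  proof -
    have "quad a b c d ` {..<4 * p} \<subseteq> B" using abcd by (auto simp: quad_def)
    then have "related w a b c d \<longleftrightarrow> (\<exists>j<card F. \<forall>i<4 * p. quad a b c d i = v j i)"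
      using xU by (auto simp: related_def code)
    also have "\<dots> \<longleftrightarrow> (\<exists>j<card F. h j = (a, b, c, d))"
    proof -
      have "(\<forall>i<4 * p. quad a b c d i = v j i) \<longleftrightarrow> h j = (a, b, c, d)" for j
        by (cases "h j") (auto simp: v_def quad_eq_iff)
      then show ?thesis by simp
    qed
    also have "\<dots> \<longleftrightarrow> (a, b, c, d) \<in> F"
    proof -
      have "h ` {0..<card F} = F" using h by (simp add: bij_betw_def)
      moreover have "(\<exists>j<n. h j = x) \<longleftrightarrow> x \<in> h ` {0..<n}" for n x by auto
      ultimately show ?thesis by metis
    qed
    finally show ?thesis .
  qed
  then show ?thesis using that w by blast
qed

section \<open>Comparing products of cardinalities\<close>

definition prod_embeds :: "(nat \<Rightarrow> 'a) \<Rightarrow> 'a set \<Rightarrow> 'a set \<Rightarrow> 'a set \<Rightarrow> 'a set \<Rightarrow> bool" where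
  "prod_embeds u S T S' T' \<longleftrightarrow>
     (\<forall>s \<in> S. \<forall>t \<in> T. \<exists>s' \<in> S'. \<exists>t' \<in> T'. related u s t s' t') \<and>
     (\<forall>s \<in> S. \<forall>t \<in> T. \<forall>s1 \<in> S. \<forall>t1 \<in> T. \<forall>s' \<in> S'. \<forall>t' \<in> T'.
        related u s t s' t' \<longrightarrow> related u s1 t1 s' t' \<longrightarrow> s = s1 \<and> t = t1)"

text \<open>The graph of an injection is a finite quaternary relation on the closed set
  \<open>B\<close>, hence coded by some \<open>u\<close>. Conversely, \<open>u\<close> may relate a
  pair to several pairs: a choice among them is a function, and the second clause of
  \<open>prod_embeds\<close> makes it injective.\<close>

lemma card_le_iff_prod_embeds:
  assumes B: "cl B" and sub: "S \<subseteq> B" "T \<subseteq> B" "S' \<subseteq> B" "T' \<subseteq> B"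
  shows "card S * card T \<le> card S' * card T' \<longleftrightarrow>
    (\<exists>u. u ` {..q} \<subseteq> univ M \<and> prod_embeds u S T S' T')"
proof -
  have "finite B" using B by (simp add: hclosed_def)
  then have fin: "finite S" "finite T" "finite S'" "finite T'" using sub by (auto intro: finite_subset)
  show ?thesis
  proof
    assume "card S * card T \<le> card S' * card T'"
    then have "card (S \<times> T) \<le> card (S' \<times> T')" by (simp add: card_cartesian_product)
    moreover have "finite (S \<times> T)" "finite (S' \<times> T')" using fin by auto
    ultimately have "\<exists>h. h ` (S \<times> T) \<subseteq> S' \<times> T' \<and> inj_on h (S \<times> T)" by (intro card_le_inj)
    then obtain h where h: "h ` (S \<times> T) \<subseteq> S' \<times> T'" "inj_on h (S \<times> T)" by (elim exE conjE)
    define F where "F = (\<lambda>(s, t). (s, t, h (s, t))) ` (S \<times> T)"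
    have "F \<subseteq> B \<times> B \<times> B \<times> B"
    proof
      fix x assume "x \<in> F"
      then obtain s t where x: "s \<in> S" "t \<in> T" "x = (s, t, h (s, t))" by (auto simp: F_def)
      then have "h (s, t) \<in> S' \<times> T'" using h(1) by blast
      then have "h (s, t) \<in> B \<times> B" using sub by (cases "h (s, t)") auto
      then show "x \<in> B \<times> B \<times> B \<times> B" using x sub by auto
    qed
    then obtain u where u: "u ` {..q} \<subseteq> univ M"
      "\<And>a b c d. {a, b, c, d} \<subseteq> B \<Longrightarrow> related u a b c d \<longleftrightarrow> (a, b, c, d) \<in> F"
      using exists_related[OF B] by metis
    have rel: "related u s t s' t' \<longleftrightarrow> h (s, t) = (s', t')"
      if st: "s \<in> S" "t \<in> T" "s' \<in> S'" "t' \<in> T'" for s t s' t'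
    proof -
      have "related u s t s' t' \<longleftrightarrow> (s, t, s', t') \<in> F" using st sub by (intro u(2)) blast
      then show ?thesis using st by (force simp: F_def image_iff)
    qed
    have "prod_embeds u S T S' T'"
      unfolding prod_embeds_def
    proof (intro conjI ballI impI)
      fix s t assume st: "s \<in> S" "t \<in> T"
      then have "h (s, t) \<in> S' \<times> T'" using h(1) by blast
      then obtain s' t' where "h (s, t) = (s', t')" "s' \<in> S'" "t' \<in> T'" by auto
      then show "\<exists>s' \<in> S'. \<exists>t' \<in> T'. related u s t s' t'" using rel st by blast
    next
      fix s t s1 t1 s' t'
      assume *: "s \<in> S" "t \<in> T" "s1 \<in> S" "t1 \<in> T" "s' \<in> S'" "t' \<in> T'"
        "related u s t s' t'" "related u s1 t1 s' t'"
      then have "h (s, t) = h (s1, t1)" using rel by metis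
      then have "(s, t) = (s1, t1)" using h(2) * by (simp add: inj_on_def)
      then show "s = s1" "t = t1" by auto
    qed
    then show "\<exists>u. u ` {..q} \<subseteq> univ M \<and> prod_embeds u S T S' T'" using u(1) by blast
  next
    assume "\<exists>u. u ` {..q} \<subseteq> univ M \<and> prod_embeds u S T S' T'"
    then obtain u where u: "prod_embeds u S T S' T'" by blast
    define h where "h st = (SOME st'. st' \<in> S' \<times> T' \<and> related u (fst st) (snd st) (fst st') (snd st'))"
      for st
    have h: "h st \<in> S' \<times> T' \<and> related u (fst st) (snd st) (fst (h st)) (snd (h st))"
      if "st \<in> S \<times> T" for st
      unfolding h_def by (rule someI_ex) (use u that in \<open>fastforce simp: prod_embeds_def\<close>)
    have "inj_on h (S \<times> T)"
    proof (rule inj_onI)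
      fix x y assume xy: "x \<in> S \<times> T" "y \<in> S \<times> T" "h x = h y"
      have "fst x = fst y \<and> snd x = snd y"
        using u h[OF xy(1)] h[OF xy(2)] xy unfolding prod_embeds_def by (metis mem_Times_iff)
      then show "x = y" by (simp add: prod_eq_iff)
    qed
    moreover have "h ` (S \<times> T) \<subseteq> S' \<times> T'" using h by blast
    ultimately have "card (S \<times> T) \<le> card (S' \<times> T')" using fin by (intro card_inj_on_le) auto
    then show "card S * card T \<le> card S' * card T'" by (simp add: card_cartesian_product)
  qed
qed

end

section \<open>Definable predicates\<close>

lemma sat_cong:
  assumes "\<And>i. i \<in> free_vars \<psi> \<Longrightarrow> f i = f' i"
  shows "sat A f \<psi> = sat A f' \<psi>"
  using assms
proof (induction \<psi> arbitrary: f f')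
  case (Atom r js)
  then have "map f js = map f' js" by simp
  then show ?case by (simp only: sat.simps)
next
  case (Conj \<psi> \<chi>)
  have "sat A f \<psi> = sat A f' \<psi>" by (rule Conj.IH(1)) (use Conj.prems in simp)
  moreover have "sat A f \<chi> = sat A f' \<chi>" by (rule Conj.IH(2)) (use Conj.prems in simp)
  ultimately show ?case by simp
next
  case (Neg \<psi>)
  then have "sat A f \<psi> = sat A f' \<psi>" by (intro Neg.IH) simp
  then show ?case by simp
next
  case (Ex j \<psi>)
  have "sat A (f(j := a)) \<psi> = sat A (f'(j := a)) \<psi>" for a
    using Ex.prems by (intro Ex.IH) auto
  then show ?case by simp
qed simp

text \<open>Stated for predicates on valuations, so that closure properties replace writing out
  formulas.\<close>

definition definable :: "('r \<Rightarrow> nat) \<Rightarrow> ('r, 'a) struct \<Rightarrow> nat \<Rightarrow> ((nat \<Rightarrow> 'a) \<Rightarrow> bool) \<Rightarrow> bool" where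
  "definable ar A n P \<longleftrightarrow>
     (\<exists>\<phi>. fm_in ar n \<phi> \<and> (\<forall>e. (\<forall>i<n. e i \<in> univ A) \<longrightarrow> sat A e \<phi> = P e))"

lemma definable_cong:
  assumes "definable ar A n P" "\<And>e. \<forall>i<n. e i \<in> univ A \<Longrightarrow> P e = Q e"
  shows "definable ar A n Q"
  using assms unfolding definable_def by metis

lemma definable_eq: "i < n \<Longrightarrow> j < n \<Longrightarrow> definable ar A n (\<lambda>e. e i = e j)"
  unfolding definable_def by (rule exI[of _ "Equal i j"]) (simp add: fm_in_def)

lemma definable_atom:
  assumes "length is = ar r" "set is \<subseteq> {..<n}"
  shows "definable ar A n (\<lambda>e. map e is \<in> rel A r)"
  unfolding definable_def by (rule exI[of _ "Atom r is"]) (simp add: fm_in_def assms)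

lemma definable_not: "definable ar A n P \<Longrightarrow> definable ar A n (\<lambda>e. \<not> P e)"
  unfolding definable_def
proof (elim exE conjE)
  fix \<phi> assume "fm_in ar n \<phi>" "\<forall>e. (\<forall>i<n. e i \<in> univ A) \<longrightarrow> sat A e \<phi> = P e"
  then show "\<exists>\<phi>. fm_in ar n \<phi> \<and> (\<forall>e. (\<forall>i<n. e i \<in> univ A) \<longrightarrow> sat A e \<phi> = (\<not> P e))"
    by (intro exI[of _ "Neg \<phi>"]) (simp add: fm_in_def)
qed

lemma definable_conj:
  "definable ar A n P \<Longrightarrow> definable ar A n Q \<Longrightarrow> definable ar A n (\<lambda>e. P e \<and> Q e)"
  unfolding definable_def
proof (elim exE conjE)
  fix \<phi> \<psi> assume "fm_in ar n \<phi>" "\<forall>e. (\<forall>i<n. e i \<in> univ A) \<longrightarrow> sat A e \<phi> = P e"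
    "fm_in ar n \<psi>" "\<forall>e. (\<forall>i<n. e i \<in> univ A) \<longrightarrow> sat A e \<psi> = Q e"
  then show "\<exists>\<phi>. fm_in ar n \<phi> \<and> (\<forall>e. (\<forall>i<n. e i \<in> univ A) \<longrightarrow> sat A e \<phi> = (P e \<and> Q e))"
    by (intro exI[of _ "Conj \<phi> \<psi>"]) (simp add: fm_in_def)
qed

lemma definable_True: "definable ar A n (\<lambda>_. True)"
  unfolding definable_def
  \<comment> \<open>A tautology without free variables, available for n = 0 and over an empty
    universe.\<close>
  by (rule exI[of _ "Neg (Conj (Ex 0 (Equal 0 0)) (Neg (Ex 0 (Equal 0 0))))"]) (simp add: fm_in_def)

lemma definable_imp:
  assumes "definable ar A n P" "definable ar A n Q"
  shows "definable ar A n (\<lambda>e. P e \<longrightarrow> Q e)"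
  by (rule definable_cong[OF definable_not[OF definable_conj[OF assms(1) definable_not[OF assms(2)]]]])
    simp

text \<open>For side conditions on indices, which are decided outside the structure.\<close>

lemma definable_const_imp:
  assumes "c \<Longrightarrow> definable ar A n P"
  shows "definable ar A n (\<lambda>e. c \<longrightarrow> P e)"
  using assms definable_True[of ar A n] by (cases c) simp_all

lemma definable_ball:
  assumes "finite I" "\<And>i. i \<in> I \<Longrightarrow> definable ar A n (\<lambda>e. P e i)"
  shows "definable ar A n (\<lambda>e. \<forall>i \<in> I. P e i)"
  using assms
proof (induction I rule: finite_induct)
  case (insert x I)
  then have "definable ar A n (\<lambda>e. P e x \<and> (\<forall>i \<in> I. P e i))" by (intro definable_conj) auto
  then show ?case by simp
qed (simp add: definable_True)

lemma definable_ex: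
  assumes "definable ar A (Suc n) P"
  shows "definable ar A n (\<lambda>e. \<exists>x \<in> univ A. P (e(n := x)))"
proof -
  obtain \<phi> where \<phi>: "fm_in ar (Suc n) \<phi>"
    "\<And>e. \<forall>i<Suc n. e i \<in> univ A \<Longrightarrow> sat A e \<phi> = P e"
    using assms by (auto simp: definable_def)
  have "fm_in ar n (Ex n \<phi>)"
    using \<phi>(1) by (auto simp: fm_in_def lessThan_Suc)
  moreover have "sat A e (Ex n \<phi>) = (\<exists>x \<in> univ A. P (e(n := x)))" if "\<forall>i<n. e i \<in> univ A" for e
    using that by (auto simp: \<phi>(2) less_Suc_eq)
  ultimately show ?thesis unfolding definable_def by blast
qed

text \<open>The second assumption says that the dependence of \<open>Q\<close> on the bound variable is only through its
  last argument, so that no variable names occur in the conclusion.\<close>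

lemma definable_bex:
  assumes "definable ar A (Suc n) (\<lambda>e. Q e (e n))" "\<And>e x. Q (e(n := x)) x = Q e x"
  shows "definable ar A n (\<lambda>e. \<exists>x \<in> univ A. Q e x)"
  using definable_ex[OF assms(1)] assms(2) by simp

definition join :: "nat \<Rightarrow> (nat \<Rightarrow> 'a) \<Rightarrow> (nat \<Rightarrow> 'a) \<Rightarrow> nat \<Rightarrow> 'a" where
  "join n e z i = (if i < n then e i else z (i - n))"

lemma join_simps [simp]: "i < n \<Longrightarrow> join n e z i = e i" "join n e z (n + i) = z i"
  by (simp_all add: join_def)

text \<open>One quantifier at a time: the innermost binds the last index of the block, and updating
  \<open>join n e z\<close> there amounts to updating \<open>z\<close>.\<close>

lemma definable_block:
  assumes "definable ar A (n + k) P"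
  shows "definable ar A n (\<lambda>e. \<exists>z. (\<forall>i<k. z i \<in> univ A) \<and> P (join n e z))"
  using assms
proof (induction k arbitrary: P)
  case 0
  \<comment> \<open>The two valuations agree only below n, and \<open>P\<close> is any predicate on
    valuations; that it ignores the other indices is seen from its defining formula.\<close>
  have "P (join n e z) = P e" if e: "\<forall>i<n. e i \<in> univ A" for e z
  proof -
    obtain \<phi> where \<phi>: "fm_in ar n \<phi>" "\<And>e. \<forall>i<n. e i \<in> univ A \<Longrightarrow> sat A e \<phi> = P e"
      using 0 by (auto simp: definable_def)
    have "join n e z i = e i" if "i \<in> free_vars \<phi>" for i
      using \<phi>(1) that by (intro join_simps) (auto simp: fm_in_def)
    then have "sat A (join n e z) \<phi> = sat A e \<phi>" by (rule sat_cong)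
    then show ?thesis using \<phi>(2) e by simp
  qed
  then show ?case using definable_cong[of ar A n P] 0 by auto
next
  case (Suc k)
  have "definable ar A (n + k) (\<lambda>e. \<exists>x \<in> univ A. P (e(n + k := x)))"
    using Suc.prems by (intro definable_ex) simp
  from Suc.IH[OF this] have
    *: "definable ar A n (\<lambda>e. \<exists>z. (\<forall>i<k. z i \<in> univ A) \<and> (\<exists>x \<in> univ A. P ((join n e z)(n + k := x))))" .
  have upd: "(join n e z)(n + k := x) = join n e (z(k := x))" for e z x
    by (rule ext) (auto simp: join_def)
  have "(\<exists>z. (\<forall>i<k. z i \<in> univ A) \<and> (\<exists>x \<in> univ A. P ((join n e z)(n + k := x))))
      \<longleftrightarrow> (\<exists>z. (\<forall>i<Suc k. z i \<in> univ A) \<and> P (join n e z))" for e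
  proof
    assume "\<exists>z. (\<forall>i<k. z i \<in> univ A) \<and> (\<exists>x \<in> univ A. P ((join n e z)(n + k := x)))"
    then obtain z x where z: "\<forall>i<k. z i \<in> univ A" "x \<in> univ A" "P (join n e (z(k := x)))"
      unfolding upd by blast
    have "\<forall>i<Suc k. (z(k := x)) i \<in> univ A" using z(1,2) by (simp add: less_Suc_eq)
    then show "\<exists>z. (\<forall>i<Suc k. z i \<in> univ A) \<and> P (join n e z)" using z(3) by blast
  next
    assume "\<exists>z. (\<forall>i<Suc k. z i \<in> univ A) \<and> P (join n e z)"
    then obtain z where z: "\<forall>i<Suc k. z i \<in> univ A" "P (join n e (z(k := z k)))" by auto
    then show "\<exists>z. (\<forall>i<k. z i \<in> univ A) \<and> (\<exists>x \<in> univ A. P ((join n e z)(n + k := x)))"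
      unfolding upd by (metis less_Suc_eq)
  qed
  then show ?case using * by simp
qed

lemma quad_comp: "f (quad a b c d i) = quad (f a) (f b) (f c) (f d) i"
  by (simp add: quad_def)

section \<open>Definability of gadgets, fibres and coded injections\<close>

context generic_slope
begin

abbreviation "dfn \<equiv> definable hyp_arity M"

lemma definable_edge:
  assumes "i < n" "j < n" "k < n"
  shows "dfn n (\<lambda>e. {e i, e j, e k} \<in> edges M)"
proof -
  have "dfn n (\<lambda>e. map e [i, j, k] \<in> rel M R)" using assms by (intro definable_atom) auto
  then show ?thesis using hyp_struct_mem_rel[OF hyp_struct_M] by simp
qed

lemma gadget_subset_iff:
  "gadget w v z \<subseteq> edges M \<longleftrightarrow>
    (\<forall>i \<in> {..<4 * p}. {z i, if i = 0 then w 0 else z (i - 1), v i} \<in> edges M \<and>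
       (\<forall>l \<in> {1..<deg i}. {z i, w 0, w l} \<in> edges M))"
  unfolding gadget_def link_def spokes_def by (simp only: UN_subset_iff insert_subset image_subset_iff)

lemma definable_gadget:
  assumes "\<And>i. W i < n" "\<And>i. V i < n" "\<And>i. i < 4 * p \<Longrightarrow> Z i < n"
  shows "dfn n (\<lambda>e. gadget (\<lambda>i. e (W i)) (\<lambda>i. e (V i)) (\<lambda>i. e (Z i)) \<subseteq> edges M)"
proof -
  have "dfn n (\<lambda>e. {e (Z i), if i = 0 then e (W 0) else e (Z (i - 1)), e (V i)} \<in> edges M)"
    if "i < 4 * p" for i
    using that assms by (cases "i = 0") (simp_all add: definable_edge)
  then show ?thesis
    unfolding gadget_subset_iff using assms
    by (intro definable_ball definable_conj definable_edge) auto
qed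

lemma definable_apart:
  assumes "\<And>i. W i < n" "\<And>i. V i < n" "\<And>i. i < 4 * p \<Longrightarrow> Z i < n"
  shows "dfn n (\<lambda>e. apart (\<lambda>i. e (W i)) (\<lambda>i. e (V i)) (\<lambda>i. e (Z i)))"
  unfolding apart_def using assms
  by (intro definable_conj definable_ball definable_const_imp definable_not definable_eq) auto

lemma definable_code:
  assumes W: "\<And>i. W i < n" and V: "\<And>i. V i < n" and X: "X < n"
  shows "dfn n (\<lambda>e. code (\<lambda>i. e (W i)) (\<lambda>i. e (V i)) (e X))"
proof -
  have W': "W i < n + 4 * p" and V': "V i < n + 4 * p" for i
    using W[of i] V[of i] by simp_all
  \<comment> \<open>The points of the gadget become a block of 4p bound variables starting at index
    n.\<close>
  have "dfn (n + 4 * p) (\<lambda>e. e (n + 0) = e X \<and>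
      apart (\<lambda>i. e (W i)) (\<lambda>i. e (V i)) (\<lambda>i. e (n + i)) \<and>
      gadget (\<lambda>i. e (W i)) (\<lambda>i. e (V i)) (\<lambda>i. e (n + i)) \<subseteq> edges M)"
    using W' V' X p_pos
    by (intro definable_conj definable_eq definable_apart definable_gadget) simp_all
  from definable_block[OF this] show ?thesis
    unfolding code_def by (simp only: join_simps W V X)
qed

lemma definable_code_quad:
  assumes "\<And>i. W i < n" "a < n" "b < n" "c < n" "d < n" "x < n"
  shows "dfn n (\<lambda>e. code (\<lambda>i. e (W i)) (quad (e a) (e b) (e c) (e d)) (e x))"
proof -
  have "dfn n (\<lambda>e. code (\<lambda>i. e (W i)) (\<lambda>i. e (quad a b c d i)) (e x))"
    using assms by (intro definable_code) (simp_all add: quad_def)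
  moreover have "(\<lambda>i. e (quad a b c d i)) = quad (e a) (e b) (e c) (e d)" for e :: "nat \<Rightarrow> 'a"
    by (simp add: quad_comp fun_eq_iff)
  ultimately show ?thesis by simp
qed

lemma definable_fibre:
  assumes "\<And>i. W i < n" "b < n" "x < n"
  shows "dfn n (\<lambda>e. e x \<in> fibre (\<lambda>i. e (W i)) (e b))"
  unfolding fibre_def mem_Collect_eq using assms by (intro definable_code_quad)

lemma definable_related:
  assumes "\<And>i. W i < n" "a < n" "b < n" "c < n" "d < n"
  shows "dfn n (\<lambda>e. related (\<lambda>i. e (W i)) (e a) (e b) (e c) (e d))"
  unfolding related_def
proof (rule definable_bex)
  show "dfn (Suc n) (\<lambda>e. code (\<lambda>i. e (W i)) (quad (e a) (e b) (e c) (e d)) (e n))"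
    using assms by (intro definable_code_quad) (simp_all add: less_SucI)
qed (use assms in \<open>simp add: less_imp_neq\<close>)

lemma definable_bex_fibre:
  assumes Q: "dfn (Suc n) (\<lambda>e. Q e (e n))" "\<And>e x. Q (e(n := x)) x = Q e x"
    and W: "\<And>i. W i < n" "b < n"
  shows "dfn n (\<lambda>e. \<exists>x \<in> fibre (\<lambda>i. e (W i)) (e b). Q e x)"
proof -
  have "dfn n (\<lambda>e. \<exists>x \<in> univ M. x \<in> fibre (\<lambda>i. e (W i)) (e b) \<and> Q e x)"
    using Q W by (intro definable_bex definable_conj definable_fibre)
      (simp_all add: less_SucI less_imp_neq)
  then show ?thesis using fibre_subset_univ by (rule_tac definable_cong) blast+
qed

lemma definable_ball_fibre:
  assumes "dfn (Suc n) (\<lambda>e. Q e (e n))" "\<And>e x. Q (e(n := x)) x = Q e x"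
    "\<And>i. W i < n" "b < n"
  shows "dfn n (\<lambda>e. \<forall>x \<in> fibre (\<lambda>i. e (W i)) (e b). Q e x)"
  using assms(2) definable_not[OF definable_bex_fibre[where Q = "\<lambda>e x. \<not> Q e x",
    OF definable_not[OF assms(1)] _ assms(3,4)]]
  by simp

text \<open>The sets are arranged for cross-multiplication: \<open>b\<close> and \<open>b'\<close>
  give numerator and denominator over the base \<open>W\<close>, and \<open>c\<close> and
  \<open>c'\<close> those over \<open>W'\<close>.\<close>

lemma definable_prod_embeds:
  assumes U: "\<And>i. U i < n" and W: "\<And>i. W i < n" and W': "\<And>i. W' i < n"
    and b: "b < n" "b' < n" "c < n" "c' < n"
  shows "dfn n (\<lambda>e. prod_embeds (\<lambda>i. e (U i))
    (fibre (\<lambda>i. e (W i)) (e b)) (fibre (\<lambda>i. e (W' i)) (e c'))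
    (fibre (\<lambda>i. e (W' i)) (e c)) (fibre (\<lambda>i. e (W i)) (e b')))"
  unfolding prod_embeds_def
  by (intro definable_conj definable_ball_fibre definable_bex_fibre definable_related definable_imp
      definable_eq)
    (simp_all add: assms less_SucI less_imp_neq)

end

lemma definable_defined_set:
  assumes "definable ar A n P"
  obtains \<phi> where "fm_in ar n \<phi>"
    "\<And>xs. xs \<in> defined_set A n \<phi> \<longleftrightarrow> length xs = n \<and> set xs \<subseteq> univ A \<and> P (\<lambda>i. xs ! i)"
proof -
  obtain \<phi> where \<phi>: "fm_in ar n \<phi>" "\<And>e. \<forall>i<n. e i \<in> univ A \<Longrightarrow> sat A e \<phi> = P e"
    using assms by (auto simp: definable_def)
  have "xs \<in> defined_set A n \<phi> \<longleftrightarrow> length xs = n \<and> set xs \<subseteq> univ A \<and> P (\<lambda>i. xs ! i)" for xs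
  proof (cases "length xs = n \<and> set xs \<subseteq> univ A")
    case True
    then have "\<forall>i<n. xs ! i \<in> univ A" using nth_mem by blast
    then show ?thesis using \<phi>(2)[of "\<lambda>i. xs ! i"] by (simp add: defined_set_def)
  qed (auto simp: defined_set_def)
  then show ?thesis using that \<phi>(1) by blast
qed

section \<open>The order of the rationals\<close>

text \<open>An order isomorphism from the positive rationals onto all rationals: the first branch
  covers the nonnegative ones and the second the negative ones. Quotients of cardinalities alone
  would miss the latter.\<close>

definition pos_rat :: "rat \<Rightarrow> rat" where
  "pos_rat x = (if 1 \<le> x then x - 1 else 1 - 1 / x)"

lemma pos_rat_less:
  assumes "0 < x" "x < y"
  shows "pos_rat x < pos_rat y"
proof -
  consider "1 \<le> x" | "x < 1" "1 \<le> y" | "y < 1" using assms by linarith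
  then show ?thesis
  proof cases
    case 2
    then have "1 < 1 / x" using assms by simp
    then show ?thesis using 2 unfolding pos_rat_def by simp
  next
    case 3
    have "1 / y < 1 / x" using assms by (simp add: frac_less2)
    then show ?thesis using 3 assms by (simp add: pos_rat_def)
  qed (use assms in \<open>simp add: pos_rat_def\<close>)
qed

lemma pos_rat_less_iff: "0 < x \<Longrightarrow> 0 < y \<Longrightarrow> pos_rat x < pos_rat y \<longleftrightarrow> x < y"
  by (metis less_asym' linorder_neqE_linordered_idom pos_rat_less)

lemma pos_rat_eq_iff: "0 < x \<Longrightarrow> 0 < y \<Longrightarrow> pos_rat x = pos_rat y \<longleftrightarrow> x = y"
  by (metis less_irrefl linorder_neqE_linordered_idom pos_rat_less)

lemma pos_rat_surj: "\<exists>x>0. pos_rat x = y"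
proof (cases "0 \<le> y")
  case True
  then show ?thesis by (intro exI[of _ "y + 1"]) (simp add: pos_rat_def)
next
  case False
  then have "0 < 1 / (1 - y)" "1 / (1 - y) < 1" by auto
  then show ?thesis by (intro exI[of _ "1 / (1 - y)"]) (simp add: pos_rat_def)
qed

section \<open>Tuples that represent rationals\<close>

context generic_slope
begin

text \<open>By \<open>deg_le\<close> only \<open>w 0\<close> to \<open>w q\<close> occur in a
  gadget, so values beyond q can be fixed by convention.\<close>

lemma code_cong:
  assumes "\<And>i. i \<le> q \<Longrightarrow> w i = w' i"
  shows "code w v x = code w' v x"
proof -
  have "spokes w z i = spokes w' z i" for z and i
    using assms[of 0] assms deg_le[of i] unfolding spokes_def by (intro image_cong) auto
  moreover have "link w v z i = link w' v z i" for z and i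
    using assms[of 0] by (cases "i = 0") (simp_all add: link_def)
  ultimately have "gadget w v z = gadget w' v z" for z
    by (simp add: gadget_def)
  moreover have "apart w v z = apart w' v z" for z
    using assms by (simp add: apart_def)
  ultimately show ?thesis by (simp add: code_def)
qed

lemma fibre_cong:
  assumes "\<And>i. i \<le> q \<Longrightarrow> w i = w' i"
  shows "fibre w b = fibre w' b"
proof -
  have "code w v x = code w' v x" for v x using assms by (rule code_cong)
  then show ?thesis by (simp add: fibre_def)
qed

lemma prod_embeds_cong:
  assumes "\<And>i. i \<le> q \<Longrightarrow> u i = u' i"
  shows "prod_embeds u S T S' T' = prod_embeds u' S T S' T'"
proof -
  have "code u v x = code u' v x" for v x using assms by (rule code_cong)
  then show ?thesis by (simp add: prod_embeds_def related_def)
qed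

text \<open>The block of \<open>q + 3\<close> variables starting at \<open>k\<close> represents the quotient \<open>num e k / den e k\<close>.\<close>

definition base :: "(nat \<Rightarrow> 'a) \<Rightarrow> nat \<Rightarrow> nat \<Rightarrow> 'a" where
  "base e k = (\<lambda>i. e (k + min i q))"

definition num :: "(nat \<Rightarrow> 'a) \<Rightarrow> nat \<Rightarrow> nat" where
  "num e k = card (fibre (base e k) (e (k + (q + 1))))"

definition den :: "(nat \<Rightarrow> 'a) \<Rightarrow> nat \<Rightarrow> nat" where
  "den e k = card (fibre (base e k) (e (k + (q + 2))))"

text \<open>Reduces the second block of a concatenation of two tuples to the first block of a tuple
  by itself.\<close>

lemma num_shift: "num e k = num (\<lambda>i. e (k + i)) 0" and den_shift: "den e k = den (\<lambda>i. e (k + i)) 0"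
  by (simp_all add: num_def den_def base_def)

lemma num_cong: "(\<And>i. i < q + 3 \<Longrightarrow> e i = e' i) \<Longrightarrow> num e 0 = num e' 0"
  and den_cong: "(\<And>i. i < q + 3 \<Longrightarrow> e i = e' i) \<Longrightarrow> den e 0 = den e' 0"
  using fibre_cong[of "base e 0" "base e' 0"] by (simp_all add: num_def den_def base_def)

lemma definable_quotient_le:
  assumes k: "k + (q + 3) \<le> n" and l: "l + (q + 3) \<le> n"
  shows "dfn n (\<lambda>e. num e k * den e l \<le> num e l * den e k)"
proof -
  \<comment> \<open>\<open>min i q\<close> keeps every index inside its block, since the
    definability lemmas ask for a bound at all \<open>i\<close>. The q + 1 indices from n on hold
    the coding tuple, which is quantified afterwards.\<close>
  have "dfn (n + Suc q) (\<lambda>e. prod_embeds (\<lambda>i. e (n + min i q))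
      (fibre (\<lambda>i. e (k + min i q)) (e (k + (q + 1)))) (fibre (\<lambda>i. e (l + min i q)) (e (l + (q + 2))))
      (fibre (\<lambda>i. e (l + min i q)) (e (l + (q + 1)))) (fibre (\<lambda>i. e (k + min i q)) (e (k + (q + 2)))))"
    using k l by (intro definable_prod_embeds) auto
  from definable_block[OF this] show ?thesis
  proof (rule definable_cong)
    fix e :: "nat \<Rightarrow> 'a" assume e: "\<forall>i<n. e i \<in> univ M"
    \<comment> \<open>A closed set around all variables contains the four fibres, as
      \<open>card_le_iff_prod_embeds\<close> requires.\<close>
    obtain B where B: "e ` {..<n} \<subseteq> B" "cl B" using exists_closed[of "e ` {..<n}"] e by auto
    have sub: "fibre (base e j) (e (j + (q + i))) \<subseteq> B" if "j + (q + 3) \<le> n" "i < 3" for i j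
      using B that by (intro fibre_subset_closed) (auto simp: base_def)
    have "num e k * den e l \<le> num e l * den e k \<longleftrightarrow>
      (\<exists>u. u ` {..q} \<subseteq> univ M \<and> prod_embeds u (fibre (base e k) (e (k + (q + 1))))
        (fibre (base e l) (e (l + (q + 2)))) (fibre (base e l) (e (l + (q + 1))))
        (fibre (base e k) (e (k + (q + 2)))))"
      unfolding num_def den_def using k l by (intro card_le_iff_prod_embeds[OF B(2)] sub) auto
    also have "\<dots> \<longleftrightarrow>
      (\<exists>u. (\<forall>i<Suc q. u i \<in> univ M) \<and> prod_embeds (\<lambda>i. u (min i q)) (fibre (base e k) (e (k + (q + 1))))
        (fibre (base e l) (e (l + (q + 2)))) (fibre (base e l) (e (l + (q + 1))))
        (fibre (base e k) (e (k + (q + 2)))))"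
      using prod_embeds_cong[of "\<lambda>i. u (min i q)" u for u]
      by (simp add: image_subset_iff less_Suc_eq_le Ball_def)
    also have "\<dots> \<longleftrightarrow> (\<exists>z. (\<forall>i<Suc q. z i \<in> univ M) \<and>
        prod_embeds (\<lambda>i. join n e z (n + min i q))
          (fibre (\<lambda>i. join n e z (k + min i q)) (join n e z (k + (q + 1))))
          (fibre (\<lambda>i. join n e z (l + min i q)) (join n e z (l + (q + 2))))
          (fibre (\<lambda>i. join n e z (l + min i q)) (join n e z (l + (q + 1))))
          (fibre (\<lambda>i. join n e z (k + min i q)) (join n e z (k + (q + 2)))))"
    proof -
      have "k + min i q < n" "l + min i q < n" for i using k l by auto
      moreover have "k + (q + 1) < n" "k + (q + 2) < n" "l + (q + 1) < n" "l + (q + 2) < n"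
        using k l by auto
      ultimately show ?thesis unfolding base_def by (simp only: join_simps)
    qed
    finally show "(\<exists>z. (\<forall>i<Suc q. z i \<in> univ M) \<and>
        prod_embeds (\<lambda>i. join n e z (n + min i q))
          (fibre (\<lambda>i. join n e z (k + min i q)) (join n e z (k + (q + 1))))
          (fibre (\<lambda>i. join n e z (l + min i q)) (join n e z (l + (q + 2))))
          (fibre (\<lambda>i. join n e z (l + min i q)) (join n e z (l + (q + 1))))
          (fibre (\<lambda>i. join n e z (k + min i q)) (join n e z (k + (q + 2)))))
      = (num e k * den e l \<le> num e l * den e k)" by blast
  qed
qed

lemma definable_quotient_pos: "dfn (q + 3) (\<lambda>e. 0 < num e 0 \<and> 0 < den e 0)"
proof -
  have "dfn (q + 3) (\<lambda>e. \<exists>x \<in> fibre (\<lambda>i. e (min i q)) (e b). True)" if "b < q + 3" for b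
    using that by (intro definable_bex_fibre definable_True) auto
  from definable_conj[OF this this, of "q + 1" "q + 2"] show ?thesis
  proof (rule definable_cong)
    fix e :: "nat \<Rightarrow> 'a" assume e: "\<forall>i<q + 3. e i \<in> univ M"
    \<comment> \<open>Infinite sets have \<open>card\<close> 0, so finiteness is what turns
      nonemptiness into positive cardinality.\<close>
    have "finite (fibre (\<lambda>i. e (min i q)) (e b))" if "b < q + 3" for b
      using e that by (intro finite_fibre) auto
    from this[of "q + 1"] this[of "q + 2"]
    show "((\<exists>x \<in> fibre (\<lambda>i. e (min i q)) (e (q + 1)). True) \<and>
        (\<exists>x \<in> fibre (\<lambda>i. e (min i q)) (e (q + 2)). True)) = (0 < num e 0 \<and> 0 < den e 0)"
      by (auto simp: num_def den_def base_def card_gt_0_iff)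
  qed auto
qed

lemma exists_quotient:
  obtains xs where "length xs = q + 3" "set xs \<subseteq> univ M"
    "num (\<lambda>i. xs ! i) 0 = m" "den (\<lambda>i. xs ! i) 0 = n"
proof -
  obtain w b b' where w: "w ` {..q} \<subseteq> univ M" "b \<in> univ M" "b' \<in> univ M"
    "card (fibre w b) = m" "card (fibre w b') = n"
    by (rule exists_fibres)
  define xs where "xs = map w [0..<Suc q] @ [b, b']"
  have "length xs = q + 3" "set xs \<subseteq> univ M"
    using w(1-3) by (auto simp: xs_def image_subset_iff simp del: upt_Suc)
  moreover have "fibre (base (\<lambda>i. xs ! i) 0) c = fibre w c" for c
    by (rule fibre_cong) (auto simp: base_def xs_def nth_append simp del: upt_Suc)
  moreover have "xs ! (q + 1) = b" "xs ! (q + 2) = b'"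
    by (simp_all add: xs_def nth_append del: upt_Suc)
  ultimately show ?thesis using that w(4,5) by (simp add: num_def den_def)
qed

definition quotient :: "'a list \<Rightarrow> rat" where
  "quotient xs = of_nat (num (\<lambda>i. xs ! i) 0) / of_nat (den (\<lambda>i. xs ! i) 0)"

lemma interpretable_rat_order: "interpretable_in ord_arity rat_order hyp_arity M"
proof -
  let ?n = "q + 3"
  \<comment> \<open>For positive denominators these are the two comparisons of the quotients;
    together they define equality, and the negation of the second defines the strict order.\<close>
  let ?le = "\<lambda>e. num e 0 * den e ?n \<le> num e ?n * den e 0"
  let ?ge = "\<lambda>e. num e ?n * den e 0 \<le> num e 0 * den e ?n"
  have le: "dfn (2 * ?n) ?le" and ge: "dfn (2 * ?n) ?ge"
    by (rule definable_quotient_le; simp)+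
  obtain dom where dom: "fm_in hyp_arity ?n dom" "\<And>xs. xs \<in> defined_set M ?n dom \<longleftrightarrow>
      length xs = ?n \<and> set xs \<subseteq> univ M \<and> 0 < num (\<lambda>i. xs ! i) 0 \<and> 0 < den (\<lambda>i. xs ! i) 0"
    by (rule definable_defined_set[OF definable_quotient_pos]) blast
  obtain eq where eq: "fm_in hyp_arity (2 * ?n) eq" "\<And>xs. xs \<in> defined_set M (2 * ?n) eq \<longleftrightarrow>
      length xs = 2 * ?n \<and> set xs \<subseteq> univ M \<and> ?le (\<lambda>i. xs ! i) \<and> ?ge (\<lambda>i. xs ! i)"
    by (rule definable_defined_set[OF definable_conj[OF le ge]]) blast
  obtain lt where lt: "fm_in hyp_arity (2 * ?n) lt" "\<And>xs. xs \<in> defined_set M (2 * ?n) lt \<longleftrightarrow>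
      length xs = 2 * ?n \<and> set xs \<subseteq> univ M \<and> \<not> ?ge (\<lambda>i. xs ! i)"
    by (rule definable_defined_set[OF definable_not[OF ge]]) blast
  let ?D = "defined_set M ?n dom"
  let ?f = "\<lambda>xs. pos_rat (quotient xs)"
  have app: "num (\<lambda>i. (xs @ ys) ! i) 0 = num (\<lambda>i. xs ! i) 0" "den (\<lambda>i. (xs @ ys) ! i) 0 = den (\<lambda>i. xs ! i) 0"
    "num (\<lambda>i. (xs @ ys) ! i) ?n = num (\<lambda>i. ys ! i) 0" "den (\<lambda>i. (xs @ ys) ! i) ?n = den (\<lambda>i. ys ! i) 0"
    if "length xs = ?n" for xs ys :: "'a list"
  proof -
    show "num (\<lambda>i. (xs @ ys) ! i) 0 = num (\<lambda>i. xs ! i) 0" "den (\<lambda>i. (xs @ ys) ! i) 0 = den (\<lambda>i. xs ! i) 0"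
      using that by (intro num_cong den_cong; simp add: nth_append)+
    have "(\<lambda>i. (xs @ ys) ! (?n + i)) = (\<lambda>i. ys ! i)" using that by (simp add: nth_append flip: that)
    then show "num (\<lambda>i. (xs @ ys) ! i) ?n = num (\<lambda>i. ys ! i) 0"
      "den (\<lambda>i. (xs @ ys) ! i) ?n = den (\<lambda>i. ys ! i) 0"
      by (subst num_shift den_shift, simp)+
  qed
  have pos: "0 < quotient xs" if "xs \<in> ?D" for xs
    using that by (simp add: dom(2) quotient_def)
  have cmp: "quotient xs \<le> quotient ys \<longleftrightarrow> ?le (\<lambda>i. (xs @ ys) ! i)"
    "quotient ys \<le> quotient xs \<longleftrightarrow> ?ge (\<lambda>i. (xs @ ys) ! i)"
    if "xs \<in> ?D" "ys \<in> ?D" for xs ys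
    using that app[of xs ys] unfolding dom(2) quotient_def
    by (simp_all add: divide_simps flip: of_nat_mult)
  have memD: "length (xs @ ys) = 2 * ?n \<and> set (xs @ ys) \<subseteq> univ M" if "xs \<in> ?D" "ys \<in> ?D" for xs ys
    using that by (simp add: dom(2))
  have "?f ` ?D = univ rat_order"
  proof -
    have "y \<in> ?f ` ?D" for y
    proof -
      obtain x where x: "0 < x" "pos_rat x = y" using pos_rat_surj by blast
      \<comment> \<open>Numerator and denominator of \<open>x\<close> are realised as the sizes of
        two fibres over one base.\<close>
      obtain a b where ab: "quotient_of x = (a, b)" by force
      have b: "0 < b" using quotient_of_denom_pos[OF ab] .
      have xab: "x = of_int a / of_int b" using quotient_of_div[OF ab] .
      then have a: "0 < a" using x(1) b by (simp add: zero_less_divide_iff)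
      obtain xs where xs: "length xs = ?n" "set xs \<subseteq> univ M"
        "num (\<lambda>i. xs ! i) 0 = nat a" "den (\<lambda>i. xs ! i) 0 = nat b"
        by (rule exists_quotient)
      have "quotient xs = x" using xs a b by (simp add: quotient_def xab)
      moreover have "xs \<in> ?D" using xs a b by (simp add: dom(2))
      ultimately show ?thesis using x(2) by blast
    qed
    then show ?thesis by (auto simp: rat_order_def)
  qed
  moreover have "?f xs = ?f ys \<longleftrightarrow> xs @ ys \<in> defined_set M (2 * ?n) eq"
    if "xs \<in> ?D" "ys \<in> ?D" for xs ys
    using memD[OF that] cmp[OF that] pos that
    by (auto simp only: eq(2) pos_rat_eq_iff)
  moreover have "map ?f xss \<in> rel rat_order s \<longleftrightarrow> concat xss \<in> defined_set M (ord_arity s * ?n) lt"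
    if xss: "xss \<in> lists ?D" "length xss = ord_arity s" for s xss
  proof -
    have s2: "ord_arity s = 2" by (cases s) simp
    then obtain xs ys where xy: "xss = [xs, ys]"
      using xss(2) by (auto simp: length_Suc_conv numeral_2_eq_2)
    then have D: "xs \<in> ?D" "ys \<in> ?D" using xss(1) by auto
    have "map ?f xss \<in> rel rat_order s \<longleftrightarrow> quotient xs < quotient ys"
      using pos_rat_less_iff[OF pos[OF D(1)] pos[OF D(2)]] by (simp add: rat_order_def xy)
    also have "\<dots> \<longleftrightarrow> xs @ ys \<in> defined_set M (2 * ?n) lt"
      using memD[OF D] cmp(2)[OF D] by (simp only: lt(2) not_le[symmetric]) simp
    finally show ?thesis by (simp add: xy s2)
  qed
  moreover have "fm_in hyp_arity (ord_arity s * ?n) lt" for s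
    using lt(1) by (cases s) simp
  ultimately have "?n > 0 \<and> fm_in hyp_arity ?n dom \<and> fm_in hyp_arity (2 * ?n) eq \<and>
    (\<forall>s. fm_in hyp_arity (ord_arity s * ?n) lt) \<and> ?f ` ?D = univ rat_order \<and>
    (\<forall>xs \<in> ?D. \<forall>ys \<in> ?D. ?f xs = ?f ys \<longleftrightarrow> xs @ ys \<in> defined_set M (2 * ?n) eq) \<and>
    (\<forall>s. \<forall>xss \<in> lists ?D. length xss = ord_arity s \<longrightarrow>
      (map ?f xss \<in> rel rat_order s \<longleftrightarrow> concat xss \<in> defined_set M (ord_arity s * ?n) lt))"
    using dom(1) eq(1) by (intro conjI allI ballI impI) (blast | simp)+
  then show ?thesis
    unfolding interpretable_in_def
    by (intro exI[of _ ?n] exI[of _ dom] exI[of _ eq] exI[of _ "\<lambda>_. lt"] exI[of _ ?f])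
qed

end

theorem lemma3p3:
  fixes \<alpha> :: real and M :: "(hyp_sym, 'a::infinite) struct"
  assumes "0 < \<alpha>" and "\<alpha> \<le> 1" and "\<alpha> \<in> \<rat>"
    and "generic \<alpha> M"
  shows "interpretable_in ord_arity rat_order hyp_arity M"
proof -
  obtain p q :: nat where pq: "q \<noteq> 0" "\<bar>\<alpha>\<bar> = real p / real q"
    using Rats_abs_nat_div_natE[OF assms(3)] by metis
  then have \<alpha>: "\<alpha> = real p / real q" using assms(1) by simp
  have "0 < p" using assms(1) \<alpha> by (cases "p = 0") auto
  moreover have "p \<le> q" using assms(2) \<alpha> pq(1) by (simp add: divide_le_eq_1)
  ultimately interpret generic_slope p q M
    using assms(4) \<alpha> by unfold_locales auto
  show ?thesis by (rule interpretable_rat_order)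
qed

end
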